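(* Let $\phi:\mathbb{R}\to\mathbb{C}$ be defined by $\phi(t)=\sum_{k\in\mathbb{Z}}\frac{e^{-4\pi^2 i k^2 t}-1}{-4\pi^2k^2}$, where the term $k=0$ is understood as its limiting value $it$. For $\sigma\ge 0$ let $D_\sigma=\{x\in\mathbb{R} : \alpha_\phi(x)=\sigma\}$. Then for every $\alpha\in[1/2,3/4]$, \[\dim_{\mathcal H}\phi(D_\alpha)\le \dim_{\mathcal H}\phi\Big(\bigcup_{\sigma\le\alpha}D_\sigma\Big)\le \frac{4\alpha-2}{\alpha}.\]
   Context: For $\beta\ge0$ and $x_0\in\mathbb{R}$, a function $f:\mathbb{R}\to\mathbb{C}$ is in $C^\beta(x_0)$ if there exist a polynomial $P$ (complex coefficients) with $\deg P\le\beta$ and a constant $C>0$ such that $|f(x_0+h)-P(h)|\le C|h|^\beta$ for all sufficiently small $|h|$. The Hölder exponent of $f$ at $x_0$ is $\alpha_f(x_0)=\sup\{\beta\ge0 : f\in C^\beta(x_0)\}$. $\dim_{\mathcal H}$ denotes Hausdorff dimension in $\mathbb{C}\cong\mathbb{R}^2$. *)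

theory Defs
  imports "HOL-Analysis.Analysis" "HOL-Computational_Algebra.Polynomial"
begin

(* |h|^beta with the convention |0|^0 = 1 (Isabelle has 0 powr 0 = 0) *)
definition abs_pow :: "real \<Rightarrow> real \<Rightarrow> real" where
  "abs_pow h b = (if b = 0 then 1 else \<bar>h\<bar> powr b)"

definition pointwise_holder :: "real \<Rightarrow> (real \<Rightarrow> complex) \<Rightarrow> real \<Rightarrow> bool" where
  "pointwise_holder beta f x0 \<longleftrightarrow>
     (\<exists>P :: complex poly. real (degree P) \<le> beta \<and>
        (\<exists>C>0. \<forall>\<^sub>F h in nhds 0.
            norm (f (x0 + h) - poly P (complex_of_real h)) \<le> C * abs_pow h beta))"

definition holder_exponent :: "(real \<Rightarrow> complex) \<Rightarrow> real \<Rightarrow> ereal" where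
  "holder_exponent f x0 = Sup (ereal ` {beta. beta \<ge> 0 \<and> pointwise_holder beta f x0})"

(* the function phi; the k = 0 term is its limiting value i t *)
definition phi_term :: "int \<Rightarrow> real \<Rightarrow> complex" where
  "phi_term k t = (if k = 0 then \<i> * complex_of_real t
     else (exp (- 4 * complex_of_real (pi^2) * \<i> * of_int (k^2) * complex_of_real t) - 1)
          / (- 4 * complex_of_real (pi^2) * of_int (k^2)))"

definition phi :: "real \<Rightarrow> complex" where
  "phi t = (\<Sum>\<^sub>\<infinity>k::int. phi_term k t)"

definition hausdorff_content_term :: "real \<Rightarrow> 'a::metric_space set \<Rightarrow> ennreal" where
  "hausdorff_content_term s U =
     (if U = {} then 0 else if s = 0 then 1 else ennreal (diameter U powr s))"

definition hausdorff_pre :: "real \<Rightarrow> real \<Rightarrow> 'a::metric_space set \<Rightarrow> ennreal" where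
  "hausdorff_pre delta s A =
     (INF U \<in> {U :: nat \<Rightarrow> 'a set. (\<forall>i. bounded (U i) \<and> diameter (U i) \<le> delta)
                                 \<and> A \<subseteq> (\<Union>i. U i)}.
        (\<Sum>i. hausdorff_content_term s (U i)))"

definition hausdorff_measure :: "real \<Rightarrow> 'a::metric_space set \<Rightarrow> ennreal" where
  "hausdorff_measure s A = (SUP delta \<in> {0<..}. hausdorff_pre delta s A)"

definition hausdorff_dim :: "'a::metric_space set \<Rightarrow> ereal" where
  "hausdorff_dim A = Inf (ereal ` {s. s \<ge> 0 \<and> hausdorff_measure s A = 0})"

end

theory Submission
  imports Defs "HOL-Analysis.Kronecker_Approximation_Theorem"
begin

text \<open>
  Up to an affine term, \<open>\<phi>(t)\<close> is \<open>g(x) = \<Sum> e(k\<^sup>2 x) / k\<^sup>2\<close> at \<open>x = -2\<pi>t\<close>, where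
  \<open>e(y) = exp(2\<pi>i y)\<close>, so that its increments are governed by the quadratic Weyl sums
  \<open>S\<^sub>N(x) = \<Sum>\<^sub>k\<^sub>\<le>\<^sub>N e(k\<^sup>2 x)\<close>: cutting the series at \<open>k \<approx> |h|\<^bsup>-1/2\<^esup>\<close>, the low frequencies are
  estimated through the derivative \<open>2\<pi>i S\<^sub>N\<close> and the high ones by partial summation. Since a loss of
  \<open>N\<^sup>\<epsilon>\<close> is harmless for dimensions and Hoelder exponents, Weyl differencing replaces the exact
  asymptotics of \<open>\<phi>\<close> at the rationals. It yields two estimates. If \<open>|h| \<le> q\<^sup>-\<^sup>2\<close>, then
  \<open>g(p/q + h) - g(p/q)\<close> is of order \<open>q\<^bsup>-1/2\<^esup> |h|\<^bsup>1/2-\<epsilon>\<^esup>\<close>; and if \<open>|x - p/q| \<ge> c q\<^sup>-\<^sup>\<mu>\<close> for all \<open>p/q\<close>,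
  with \<open>\<mu> \<ge> 2\<close>, then \<open>g\<close> is \<open>C\<^bsup>1/2+1/(2\<mu>)-\<epsilon>\<^esup>\<close> at \<open>x\<close>.

  By the second estimate, a point of exponent less than \<open>\<beta> = 1/2 + 1/(2\<mu>)\<close> is rational or lies
  within \<open>q\<^sup>-\<^sup>\<mu>\<close> of infinitely many \<open>p/q\<close>. By the first estimate, the image of that neighbourhood of
  \<open>p/q\<close> has diameter about \<open>q\<^bsup>-(1+\<mu>)/2\<^esup>\<close>, and \<open>\<Sum>\<^sub>q q \<cdot> q\<^bsup>-s(1+\<mu>)/2\<^esup>\<close> converges for
  \<open>s > 4/(1+\<mu>) = (4\<beta>-2)/\<beta>\<close>. Let \<open>\<beta>\<close> decrease to \<open>\<alpha>\<close>; for \<open>\<alpha> = 3/4\<close> no room is left, but every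
  irrational lies within \<open>q\<^sup>-\<^sup>2\<close> of infinitely many \<open>p/q\<close>.
\<close>


section \<open>Exponential sums\<close>

definition cis2pi :: "real \<Rightarrow> complex" where
  "cis2pi x = cis (2 * pi * x)"

lemma norm_cis2pi [simp]: "norm (cis2pi x) = 1"
  by (simp add: cis2pi_def)

lemma cis2pi_0 [simp]: "cis2pi 0 = 1"
  by (simp add: cis2pi_def)

lemma cnj_cis2pi: "cnj (cis2pi x) = cis2pi (- x)"
  by (simp add: cis2pi_def cis_cnj)

lemma cis2pi_mult: "cis2pi x * cis2pi y = cis2pi (x + y)"
  by (simp add: cis2pi_def cis_mult distrib_left)

lemma cis2pi_power: "cis2pi x ^ n = cis2pi (real n * x)"
  by (simp add: cis2pi_def Complex.DeMoivre mult_ac)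

lemma cis2pi_diff_of_int: "cis2pi (x - of_int n) = cis2pi x"
  by (simp add: cis2pi_def right_diff_distrib cis_multiple_2pi flip: cis_divide)

lemma infdist_Ints_eq_round: "infdist x \<int> = \<bar>x - of_int (round x)\<bar>" for x :: real
proof (rule antisym)
  show "infdist x \<int> \<le> \<bar>x - of_int (round x)\<bar>"
    using infdist_le[of "of_int (round x)" \<int> x] by (simp add: dist_real_def)
  have "\<bar>x - of_int (round x)\<bar> \<le> dist x a" if "a \<in> \<int>" for a
    using that round_diff_minimal[of x] by (auto simp: dist_real_def elim: Ints_cases)
  moreover have "\<int> \<noteq> ({} :: real set)"
    using Ints_0 by blast
  ultimately show "\<bar>x - of_int (round x)\<bar> \<le> infdist x \<int>"
    unfolding infdist_def by (auto intro!: cINF_greatest)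
qed

lemma infdist_Ints_add_of_int: "infdist (x + of_int n) \<int> = infdist x \<int>" for x :: real
proof -
  have "round (x + of_int n) = round x + n"
    unfolding round_def by linarith
  then show ?thesis
    by (simp add: infdist_Ints_eq_round)
qed

lemma infdist_Ints_le: "infdist x \<int> \<le> \<bar>x - of_int n\<bar>" for x :: real
  using round_diff_minimal[of x n] by (simp add: infdist_Ints_eq_round)

lemma infdist_Ints_eq:
  fixes x :: real
  assumes "\<bar>x - of_int n\<bar> \<le> 1/2"
  shows "infdist x \<int> = \<bar>x - of_int n\<bar>"
proof (rule antisym[OF infdist_Ints_le])
  define m where "m = round x"
  have "m = n \<or> 1 \<le> \<bar>real_of_int m - of_int n\<bar>"
    by linarith
  then show "\<bar>x - of_int n\<bar> \<le> infdist x \<int>"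
    using assms unfolding infdist_Ints_eq_round m_def[symmetric] by linarith
qed

lemma infdist_Ints_pos: "x \<notin> \<int> \<Longrightarrow> 0 < infdist x \<int>" for x :: real
  using infdist_pos_not_in_closed[OF closed_Ints] Ints_0 by blast

lemma Jordan_sin_ge:
  assumes "0 \<le> z" "z \<le> 1/2"
  shows "2 * z \<le> sin (pi * z)"
proof -
  have "convex_on {0..pi/2} (\<lambda>x. - sin x)"
  proof (rule convex_on_realI)
    show "((\<lambda>x. - sin x) has_real_derivative - cos x) (at x)" for x :: real
      by (auto intro!: derivative_eq_intros)
    show "- cos x \<le> - cos y" if "x \<in> {0..pi/2}" "y \<in> {0..pi/2}" "x \<le> y" for x y :: real
      using that by (auto intro!: cos_monotone_0_pi_le)
  qed simp
  from convex_onD[OF this, of "2 * z" 0 "pi/2"] show ?thesis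
    using assms by (simp add: mult.commute)
qed

lemma norm_cis2pi_minus_1_ge: "4 * infdist z \<int> \<le> norm (cis2pi z - 1)"
proof -
  define y where "y = z - of_int (round z)"
  have y: "\<bar>y\<bar> = infdist z \<int>" "\<bar>y\<bar> \<le> 1/2"
    using of_int_round_abs_le[of z] by (simp_all add: y_def infdist_Ints_eq_round abs_minus_commute)
  have "norm (cis2pi z - 1) = norm (cis2pi y - 1)"
    by (simp add: y_def cis2pi_diff_of_int)
  also have "\<dots> = 2 * \<bar>sin (pi * y)\<bar>"
    using dist_exp_i_1[of "2 * pi * y"] by (simp add: cis2pi_def cis_conv_exp)
  also have "\<bar>sin (pi * y)\<bar> = \<bar>sin (pi * \<bar>y\<bar>)\<bar>"
    by (cases "y \<ge> 0") auto
  finally show ?thesis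
    using Jordan_sin_ge[of "\<bar>y\<bar>"] y by (simp add: infdist_nonneg)
qed

lemma norm_sum_cis2pi_le:
  assumes "0 < \<delta>" "\<delta> \<le> infdist z \<int>"
  shows "norm (\<Sum>b=1..M. cis2pi (real b * z)) \<le> 1 / (2 * \<delta>)"
proof -
  define w S where "w = cis2pi z" and "S = (\<Sum>b=1..M. w ^ b)"
  have "(w - 1) * S = w ^ Suc M - w"
    unfolding S_def by (induction M) (auto simp: algebra_simps)
  then have "norm (w - 1) * norm S = norm (w ^ Suc M - w)"
    by (metis norm_mult)
  also have "\<dots> \<le> 2"
    using norm_triangle_ineq4[of "w ^ Suc M" w] by (simp add: w_def norm_power norm_mult)
  finally have "norm (w - 1) * norm S \<le> 2" .
  moreover have "4 * \<delta> \<le> norm (w - 1)"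
    using norm_cis2pi_minus_1_ge[of z] assms(2) by (simp add: w_def)
  then have "4 * \<delta> * norm S \<le> norm (w - 1) * norm S"
    by (rule mult_right_mono) simp
  ultimately show ?thesis
    using assms(1) by (simp add: S_def w_def cis2pi_power field_simps)
qed

lemma norm_sum_squared_eq_correlations:
  fixes u :: "nat \<Rightarrow> complex"
  shows "(norm (\<Sum>k=1..N. u k))\<^sup>2
    = (\<Sum>k=1..N. (norm (u k))\<^sup>2) + 2 * Re (\<Sum>d=1..N. \<Sum>b=1..N-d. u (b + d) * cnj (u b))"
proof (induction N)
  case (Suc N)
  define S where "S = (\<Sum>k=1..N. u k)"
  have "(\<Sum>d=1..Suc N. \<Sum>b=1..Suc N-d. u (b + d) * cnj (u b))
      = (\<Sum>d=1..N. \<Sum>b=1..Suc (N-d). u (b + d) * cnj (u b))"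
    by (simp add: Suc_diff_le)
  also have "\<dots> = (\<Sum>d=1..N. \<Sum>b=1..N-d. u (b + d) * cnj (u b))
      + (\<Sum>d=1..N. u (Suc N) * cnj (u (N + 1 - d)))"
    by (simp add: sum.distrib Suc_diff_le)
  also have "(\<Sum>d=1..N. u (Suc N) * cnj (u (N + 1 - d))) = u (Suc N) * cnj S"
    unfolding S_def by (subst sum.atLeastAtMost_rev) (simp add: sum_distrib_left)
  finally have "2 * Re (\<Sum>d=1..Suc N. \<Sum>b=1..Suc N-d. u (b + d) * cnj (u b))
      = 2 * Re (\<Sum>d=1..N. \<Sum>b=1..N-d. u (b + d) * cnj (u b)) + 2 * Re (u (Suc N) * cnj S)"
    by simp
  moreover have "(norm (S + u (Suc N)))\<^sup>2
      = (norm S)\<^sup>2 + (norm (u (Suc N)))\<^sup>2 + 2 * Re (u (Suc N) * cnj S)"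
    unfolding cmod_power2 by (simp add: power2_eq_square algebra_simps)
  ultimately show ?case
    using Suc by (simp add: S_def)
qed simp

definition weyl_sum :: "nat \<Rightarrow> real \<Rightarrow> complex" where
  "weyl_sum N x = (\<Sum>k=1..N. cis2pi ((real k)\<^sup>2 * x))"

lemma weyl_differencing:
  "(norm (weyl_sum N x))\<^sup>2
    \<le> real N + 2 * (\<Sum>d=1..N. norm (\<Sum>b=1..N-d. cis2pi (real b * (real (2 * d) * x))))"
proof -
  define u where "u k = cis2pi ((real k)\<^sup>2 * x)" for k
  have "u (b + d) * cnj (u b)
      = cis2pi ((real d)\<^sup>2 * x) * cis2pi (real b * (real (2 * d) * x))" for b d
    unfolding u_def cnj_cis2pi cis2pi_mult
    by (rule arg_cong[of _ _ cis2pi]) (simp add: power2_eq_square algebra_simps)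
  then have "Re (\<Sum>d=1..N. \<Sum>b=1..N-d. u (b + d) * cnj (u b))
      \<le> norm (\<Sum>d=1..N. cis2pi ((real d)\<^sup>2 * x) * (\<Sum>b=1..N-d. cis2pi (real b * (real (2 * d) * x))))"
    using complex_Re_le_cmod by (simp only: sum_distrib_left)
  also have "\<dots> \<le> (\<Sum>d=1..N. norm (\<Sum>b=1..N-d. cis2pi (real b * (real (2 * d) * x))))"
    by (rule sum_norm_le) (simp add: norm_mult)
  finally show ?thesis
    using norm_sum_squared_eq_correlations[of u N] by (simp add: weyl_sum_def u_def)
qed


section \<open>Sums over residue classes\<close>

lemma harm_le_ln: "0 < n \<Longrightarrow> harm n \<le> 1 + ln (real n)"
  using decseqD[OF decseq_harm_diff_ln, of 0 "n - 1"] by (simp add: harm_expand)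

lemma infdist_Ints_fraction_ge:
  fixes a :: int
  assumes "0 < q" "\<not> int q dvd a"
  shows "1 / real q \<le> infdist (of_int a / real q) \<int>"
proof -
  define n where "n = round (of_int a / real q)"
  have "a - int q * n \<noteq> 0"
    using assms(2) by auto
  then have "1 \<le> \<bar>a - int q * n\<bar>" by simp
  then have "1 \<le> \<bar>real_of_int (a - int q * n)\<bar>" by linarith
  then have "1 / real q \<le> \<bar>real_of_int (a - int q * n)\<bar> / real q"
    by (intro divide_right_mono) auto
  also have "\<dots> = \<bar>real_of_int (a - int q * n) / real q\<bar>"
    by simp
  also have "real_of_int (a - int q * n) / real q = of_int a / real q - of_int n"
    using assms(1) by (simp add: diff_divide_distrib)
  finally show ?thesis
    by (simp add: infdist_Ints_eq_round n_def)
qed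

lemma inverse_infdist_Ints_fraction_le:
  assumes "0 < r" "r < q"
  shows "1 / infdist (real r / real q) \<int> \<le> real q / real r + real q / real (q - r)"
proof -
  define y n where "y = real r / real q" and "n = round y"
  have y: "0 < y" "y < 1" using assms by (simp_all add: y_def)
  have "y \<le> infdist y \<int> \<or> 1 - y \<le> infdist y \<int>"
  proof (cases "n \<le> 0")
    case True
    then have "real_of_int n \<le> 0" by simp
    then show ?thesis unfolding infdist_Ints_eq_round n_def[symmetric] by linarith
  next
    case False
    then have "1 \<le> real_of_int n" by simp
    then show ?thesis unfolding infdist_Ints_eq_round n_def[symmetric] by linarith
  qed
  then have "1 / infdist y \<int> \<le> 1 / y \<or> 1 / infdist y \<int> \<le> 1 / (1 - y)"
    using y by (auto simp: frac_le)
  moreover have "1 - y = real (q - r) / real q"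
    using assms by (simp add: y_def field_simps of_nat_diff)
  ultimately show ?thesis
    using assms by (auto simp: y_def add_increasing add_increasing2)
qed

lemma sum_inverse_infdist_residues_le:
  assumes "0 < q"
  shows "(\<Sum>r=1..<q. 1 / infdist (real r / real q) \<int>) \<le> 2 * real q * (1 + ln (real q))"
proof -
  have "(\<Sum>r=1..<q. 1 / infdist (real r / real q) \<int>)
      \<le> (\<Sum>r=1..<q. real q / real r + real q / real (q - r))"
    by (intro sum_mono inverse_infdist_Ints_fraction_le) auto
  also have "\<dots> = (\<Sum>r=1..<q. real q / real r) + (\<Sum>r=1..<q. real q / real (q - r))"
    by (rule sum.distrib)
  also have "(\<Sum>r=1..<q. real q / real (q - r)) = (\<Sum>r=1..<q. real q / real r)"
    by (rule sum.reindex_bij_witness[of _ "\<lambda>r. q - r" "\<lambda>r. q - r"]) auto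
  also have "(\<Sum>r=1..<q. real q / real r) \<le> real q * harm q"
    unfolding harm_def sum_distrib_left divide_inverse by (rule sum_mono2) auto
  also have "\<dots> \<le> real q * (1 + ln (real q))"
    using harm_le_ln[OF assms] by (intro mult_left_mono) auto
  finally show ?thesis by simp
qed

lemma sum_periodic_multiples:
  fixes f :: "int \<Rightarrow> 'a :: comm_monoid_add" and p :: int
  assumes "coprime p (int q)" "0 < q" and periodic: "\<And>a. f (a mod int q) = f a"
  shows "(\<Sum>m\<in>{k..<k + q}. f (int m * p)) = (\<Sum>r<q. f (int r))"
proof -
  define g where "g m = nat (int m * p mod int q)" for m
  have int_g: "int (g m) = int m * p mod int q" for m
    using assms(2) by (simp add: g_def)
  have "inj_on g {k..<k + q}"
  proof (rule inj_onI)
    fix i j assume ij: "i \<in> {k..<k + q}" "j \<in> {k..<k + q}" "g i = g j"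
    then have "int i * p mod int q = int j * p mod int q"
      by (metis int_g)
    then have "int q dvd (int i - int j) * p"
      by (simp add: mod_eq_dvd_iff left_diff_distrib)
    then have "int q dvd int i - int j"
      using assms(1) by (simp add: coprime_dvd_mult_left_iff coprime_commute)
    moreover have "\<bar>int i - int j\<bar> < int q"
      using ij by auto
    ultimately show "i = j"
      using dvd_imp_le_int[of "int i - int j" "int q"] by auto
  qed
  moreover have "g ` {k..<k + q} \<subseteq> {..<q}"
    using assms(2) by (auto simp: g_def nat_less_iff)
  ultimately have "bij_betw g {k..<k + q} {..<q}"
    by (simp add: bij_betw_def card_subset_eq card_image)
  then have "(\<Sum>r<q. f (int r)) = (\<Sum>m\<in>{k..<k + q}. f (int (g m)))"
    by (rule sum.reindex_bij_betw[symmetric])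
  then show ?thesis
    by (simp add: int_g periodic)
qed

lemma sum_inverse_infdist_multiples_le:
  fixes p :: int
  assumes "coprime p (int q)" "0 < q"
  shows "(\<Sum>m\<in>{m \<in> {1..M}. \<not> q dvd m}. 1 / infdist (of_int (int m * p) / real q) \<int>)
    \<le> 2 * real (M + q) * (1 + ln (real q))"
proof -
  define f where "f a = (if int q dvd a then 0 else 1 / infdist (real_of_int a / real q) \<int>)" for a
  have f_nonneg: "0 \<le> f a" for a
    by (simp add: f_def infdist_nonneg)
  have f_mod: "f (a mod int q) = f a" for a
  proof -
    have "real_of_int a = real_of_int (a mod int q) + real q * of_int (a div int q)"
      by (metis mod_mult_div_eq of_int_add of_int_mult of_int_of_nat_eq)
    then have "real_of_int a / real q = real_of_int (a mod int q) / real q + of_int (a div int q)"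
      using assms(2) by (simp add: add_divide_distrib)
    then show ?thesis
      by (simp add: f_def dvd_mod_iff infdist_Ints_add_of_int)
  qed
  have f_multiple: "f (int m * p)
      = (if q dvd m then 0 else 1 / infdist (of_int (int m * p) / real q) \<int>)" for m
    using assms(1) by (simp add: f_def coprime_dvd_mult_left_iff coprime_commute)
  define B where "B = M div q + 1"
  have "M < B * q"
    using assms(2) by (simp add: B_def dividend_less_div_times)
  have "(\<Sum>m\<in>{m \<in> {1..M}. \<not> q dvd m}. 1 / infdist (of_int (int m * p) / real q) \<int>)
      = (\<Sum>m=1..M. f (int m * p))"
    by (intro sum.mono_neutral_cong_left) (auto simp: f_multiple)
  also have "\<dots> \<le> (\<Sum>m<B * q. f (int m * p))"
    using \<open>M < B * q\<close> by (intro sum_mono2) (auto simp: f_nonneg)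
  also have "\<dots> = (\<Sum>b<B. \<Sum>m\<in>{b * q..<b * q + q}. f (int m * p))"
    by (simp add: sum.nat_group)
  also have "\<dots> = real B * (\<Sum>r<q. f (int r))"
    by (simp add: sum_periodic_multiples[where f = f, OF assms f_mod])
  also have "(\<Sum>r<q. f (int r)) = (\<Sum>r=1..<q. 1 / infdist (real r / real q) \<int>)"
    by (intro sum.mono_neutral_cong_right) (auto simp: f_def Suc_le_eq dest: nat_dvd_not_less)
  also have "real B * \<dots> \<le> real B * (2 * real q * (1 + ln (real q)))"
    by (intro mult_left_mono sum_inverse_infdist_residues_le assms) auto
  also have "\<dots> = 2 * real (B * q) * (1 + ln (real q))"
    by simp
  also have "\<dots> \<le> 2 * real (M + q) * (1 + ln (real q))"
    using assms(2)
    by (intro mult_right_mono mult_left_mono) (auto simp: B_def simp flip: of_nat_add)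
  finally show ?thesis .
qed

lemma sum_multiples:
  fixes f :: "nat \<Rightarrow> 'a :: comm_monoid_add"
  assumes "0 < q"
  shows "(\<Sum>m\<in>{m \<in> {1..M}. q dvd m}. f m) = (\<Sum>l=1..M div q. f (q * l))"
  using assms
  by (intro sum.reindex_bij_witness[of _ "\<lambda>l. q * l" "\<lambda>m. m div q"])
     (auto simp: div_le_mono dvd_imp_le div_greater_zero_iff less_eq_div_iff_mult_less_eq
        mult.commute Suc_le_eq)


section \<open>Quadratic Weyl sums at a Dirichlet approximant\<close>

definition weyl_const :: "real \<Rightarrow> real" where
  "weyl_const e = sqrt (97 * (1 + 1 / (2 * e)))"

text \<open>The factor 4 leaves \<open>m x\<close> within half the spacing \<open>1/q\<close> of \<open>m p/q\<close> for all \<open>m \<le> 2N\<close>.\<close>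
locale Dirichlet_approximation =
  fixes N :: nat and x :: real and p :: int and q :: nat
  assumes coprime: "coprime p (int q)" and q_pos: "0 < q" and q_le: "q \<le> 4 * N"
    and approx: "\<bar>x - of_int p / real q\<bar> \<le> 1 / (real q * real (4 * N))"
begin

lemma N_pos: "0 < N"
  using q_pos q_le by simp

lemma ln_N_nonneg: "0 \<le> ln (real N)"
  using N_pos by simp

lemma multiple_approx:
  assumes "m \<le> 2 * N"
  shows "\<bar>real m * x - of_int (int m * p) / real q\<bar> \<le> 1 / (2 * real q)"
proof -
  have "real m * x - of_int (int m * p) / real q = real m * (x - of_int p / real q)"
    by (simp add: right_diff_distrib)
  then have "\<bar>real m * x - of_int (int m * p) / real q\<bar>
      \<le> real (2 * N) * (1 / (real q * real (4 * N)))"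
    using assms approx by (simp only: abs_mult abs_of_nat) (intro mult_mono, auto)
  then show ?thesis
    using N_pos by simp
qed

lemma infdist_fraction_multiple_ge:
  assumes "\<not> q dvd m"
  shows "1 / real q \<le> infdist (of_int (int m * p) / real q) \<int>"
proof -
  have "\<not> int q dvd int m * p"
    using assms coprime by (simp add: coprime_dvd_mult_left_iff coprime_commute)
  then show ?thesis
    by (rule infdist_Ints_fraction_ge[OF q_pos])
qed

lemma infdist_multiple_ge:
  assumes "m \<le> 2 * N" "\<not> q dvd m"
  shows "infdist (of_int (int m * p) / real q) \<int> \<le> 2 * infdist (real m * x) \<int>"
proof -
  let ?a = "of_int (int m * p) / real q"
  have "infdist ?a \<int> \<le> infdist (real m * x) \<int> + \<bar>real m * x - ?a\<bar>"
    using infdist_triangle[of ?a \<int> "real m * x"] by (simp add: dist_real_def abs_minus_commute)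
  then show ?thesis
    using infdist_fraction_multiple_ge[OF assms(2)] multiple_approx[OF assms(1)] by simp
qed

lemma norm_sum_cis2pi_multiple_le:
  assumes "m \<le> 2 * N" "\<not> q dvd m"
  shows "norm (\<Sum>b=1..M. cis2pi (real b * (real m * x)))
    \<le> 1 / infdist (of_int (int m * p) / real q) \<int>"
proof -
  define \<delta> where "\<delta> = infdist (of_int (int m * p) / real q) \<int> / 2"
  have "0 < 1 / real q"
    using q_pos by simp
  then have "0 < \<delta>"
    using infdist_fraction_multiple_ge[OF assms(2)] unfolding \<delta>_def by linarith
  moreover have "\<delta> \<le> infdist (real m * x) \<int>"
    using infdist_multiple_ge[OF assms] by (simp add: \<delta>_def)
  ultimately have "norm (\<Sum>b=1..M. cis2pi (real b * (real m * x))) \<le> 1 / (2 * \<delta>)"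
    by (rule norm_sum_cis2pi_le)
  then show ?thesis
    by (simp add: \<delta>_def)
qed

lemma infdist_multiple_eq:
  assumes "m \<le> 2 * N" "q dvd m"
  shows "infdist (real m * x) \<int> = real m * \<bar>x - of_int p / real q\<bar>"
proof -
  define n where "n = int (m div q) * p"
  have n: "of_int (int m * p) / real q = of_int n"
    using assms(2) q_pos by (auto simp: n_def elim!: dvdE)
  have "1 / (2 * real q) \<le> 1 / 2"
    using q_pos by simp
  then have "\<bar>real m * x - of_int n\<bar> \<le> 1 / 2"
    using multiple_approx[OF assms(1)] unfolding n by linarith
  then have "infdist (real m * x) \<int> = \<bar>real m * x - of_int (int m * p) / real q\<bar>"
    unfolding n by (rule infdist_Ints_eq)
  also have "real m * x - of_int (int m * p) / real q = real m * (x - of_int p / real q)"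
    by (simp add: right_diff_distrib)
  finally show ?thesis
    by (simp add: abs_mult)
qed

lemma sum_inverse_infdist_le:
  "(\<Sum>m\<in>{m \<in> {1..2 * N}. \<not> q dvd m}. 1 / infdist (of_int (int m * p) / real q) \<int>)
    \<le> 48 * real N * (1 + ln (real N))"
proof -
  have "ln (real q) \<le> ln (4 * real N)"
    using q_pos q_le by (subst ln_le_cancel_iff) auto
  also have "\<dots> = ln 4 + ln (real N)"
    using N_pos by (simp add: ln_mult)
  finally have "1 + ln (real q) \<le> 4 * (1 + ln (real N))"
    using ln_le_minus_one[of 4] ln_N_nonneg by simp
  then have "2 * real (2 * N + q) * (1 + ln (real q)) \<le> 2 * (6 * real N) * (4 * (1 + ln (real N)))"
    using q_pos q_le by (intro mult_mono) auto
  also have "\<dots> = 48 * real N * (1 + ln (real N))"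
    by simp
  finally show ?thesis
    using sum_inverse_infdist_multiples_le[OF coprime q_pos, of "2 * N"] by linarith
qed

lemma weyl_sum_squared_le_sum_multiples:
  assumes E: "\<And>m M. m \<in> {1..2 * N} \<Longrightarrow> q dvd m \<Longrightarrow> M \<le> N \<Longrightarrow>
    norm (\<Sum>b=1..M. cis2pi (real b * (real m * x))) \<le> E m"
  shows "(norm (weyl_sum N x))\<^sup>2
    \<le> real N + 2 * (\<Sum>l=1..2 * N div q. E (q * l)) + 96 * real N * (1 + ln (real N))"
proof -
  define F where
    "F m = (if q dvd m then E m else 1 / infdist (of_int (int m * p) / real q) \<int>)" for m
  have bound: "norm (\<Sum>b=1..M. cis2pi (real b * (real m * x))) \<le> F m"
    if m: "m \<in> {1..2 * N}" and M: "M \<le> N" for m M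
    using E[OF m _ M] norm_sum_cis2pi_multiple_le[of m M] m by (auto simp: F_def)
  have F_nonneg: "0 \<le> F m" if "m \<in> {1..2 * N}" for m
    using bound[OF that, of 0] by simp
  have "(\<Sum>d=1..N. norm (\<Sum>b=1..N-d. cis2pi (real b * (real (2 * d) * x)))) \<le> (\<Sum>d=1..N. F (2 * d))"
    by (intro sum_mono bound) auto
  also have "\<dots> = sum F ((\<lambda>d. 2 * d) ` {1..N})"
    by (simp add: sum.reindex inj_on_def)
  also have "\<dots> \<le> sum F {1..2 * N}"
    by (intro sum_mono2) (auto intro: F_nonneg)
  also have "\<dots> = (\<Sum>m\<in>{m \<in> {1..2 * N}. q dvd m}. E m)
      + (\<Sum>m\<in>{m \<in> {1..2 * N}. \<not> q dvd m}. 1 / infdist (of_int (int m * p) / real q) \<int>)"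
    unfolding F_def by (simp add: sum.If_cases Int_def Collect_neg_eq)
  also have "\<dots> \<le> (\<Sum>l=1..2 * N div q. E (q * l)) + 48 * real N * (1 + ln (real N))"
    by (intro add_mono sum_inverse_infdist_le eq_refl sum_multiples q_pos)
  finally show ?thesis
    using weyl_differencing[of N x] by linarith
qed

lemma weyl_sum_squared_le:
  assumes "\<And>m M. m \<in> {1..2 * N} \<Longrightarrow> q dvd m \<Longrightarrow> M \<le> N \<Longrightarrow>
      norm (\<Sum>b=1..M. cis2pi (real b * (real m * x))) \<le> E m"
    and sum: "(\<Sum>l=1..2 * N div q. E (q * l)) \<le> 2 * (1 + ln (real N)) * R" and R: "0 \<le> R"
  shows "(norm (weyl_sum N x))\<^sup>2 \<le> 97 * (1 + ln (real N)) * (real N + R)"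
proof -
  define L where "L = 1 + ln (real N)"
  have "(norm (weyl_sum N x))\<^sup>2 \<le> real N + 2 * (2 * L * R) + 96 * real N * L"
    using weyl_sum_squared_le_sum_multiples[OF assms(1)] sum by (simp add: L_def)
  also have "\<dots> = real N * 1 + 4 * (L * R) + 96 * (real N * L)"
    by simp
  also have "\<dots> \<le> real N * L + 97 * (L * R) + 96 * (real N * L)"
    using ln_N_nonneg R unfolding L_def
    by (intro add_mono mult_left_mono mult_right_mono mult_nonneg_nonneg) auto
  also have "\<dots> = 97 * L * (real N + R)"
    by (simp add: algebra_simps)
  finally show ?thesis
    by (simp add: L_def)
qed

lemma weyl_sum_squared_le_denominator:
  "(norm (weyl_sum N x))\<^sup>2 \<le> 97 * (1 + ln (real N)) * (real N + (real N)\<^sup>2 / real q)"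
proof (rule weyl_sum_squared_le)
  fix m M assume "M \<le> N"
  then show "norm (\<Sum>b=1..M. cis2pi (real b * (real m * x))) \<le> real N"
    using sum_norm_le[of "{1..M}" "\<lambda>b. cis2pi (real b * (real m * x))" "\<lambda>_. 1"] by simp
next
  have "(\<Sum>l=1..2 * N div q. real N) = real (2 * N div q) * real N"
    by simp
  also have "\<dots> \<le> real (2 * N) / real q * real N"
    by (intro mult_right_mono of_nat_div_le_of_nat) simp
  also have "\<dots> = 2 * 1 * ((real N)\<^sup>2 / real q)"
    by (simp add: power2_eq_square)
  also have "\<dots> \<le> 2 * (1 + ln (real N)) * ((real N)\<^sup>2 / real q)"
    using ln_N_nonneg by (intro mult_right_mono mult_left_mono) auto
  finally show "(\<Sum>l=1..2 * N div q. real N) \<le> 2 * (1 + ln (real N)) * ((real N)\<^sup>2 / real q)" .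
qed simp

lemma weyl_sum_squared_le_distance:
  assumes "x \<noteq> of_int p / real q"
  shows "(norm (weyl_sum N x))\<^sup>2
    \<le> 97 * (1 + ln (real N)) * (real N + 1 / (real q * \<bar>x - of_int p / real q\<bar>))"
proof -
  define \<delta> where "\<delta> = \<bar>x - of_int p / real q\<bar>"
  have \<delta>: "0 < \<delta>" using assms by (simp add: \<delta>_def)
  show ?thesis
    unfolding \<delta>_def[symmetric]
  proof (rule weyl_sum_squared_le)
    fix m M assume "m \<in> {1..2 * N}" "q dvd m"
    then show "norm (\<Sum>b=1..M. cis2pi (real b * (real m * x))) \<le> 1 / (2 * (real m * \<delta>))"
      using \<delta> by (intro norm_sum_cis2pi_le) (auto simp: infdist_multiple_eq \<delta>_def)
  next
    have "harm (2 * N div q) \<le> (harm (2 * N) :: real)"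
      by (intro harm_mono) simp
    also have "\<dots> \<le> 1 + (ln 2 + ln (real N))"
      using harm_le_ln[of "2 * N"] N_pos by (simp add: ln_mult)
    also have "\<dots> \<le> 2 * (1 + ln (real N))"
      using ln_le_minus_one[of 2] ln_N_nonneg by simp
    finally have "1 / (2 * real q * \<delta>) * harm (2 * N div q)
        \<le> 1 / (2 * real q * \<delta>) * (2 * (1 + ln (real N)))"
      by (rule mult_left_mono) (use \<delta> in simp)
    also have "\<dots> \<le> 2 * (1 + ln (real N)) * (1 / (real q * \<delta>))"
      using ln_N_nonneg \<delta> q_pos by (simp add: field_simps)
    also have "1 / (2 * real q * \<delta>) * harm (2 * N div q)
        = (\<Sum>l=1..2 * N div q. 1 / (2 * (real (q * l) * \<delta>)))"
      by (simp add: harm_def sum_distrib_left inverse_eq_divide mult_ac)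
    finally show "(\<Sum>l=1..2 * N div q. 1 / (2 * (real (q * l) * \<delta>)))
        \<le> 2 * (1 + ln (real N)) * (1 / (real q * \<delta>))" .
  qed (use \<delta> in simp)
qed

lemma norm_weyl_sum_le:
  assumes "0 < e" and a: "real N + (real N)\<^sup>2 / real q \<le> a * (real N)\<^sup>2 \<or>
    x \<noteq> of_int p / real q \<and> real N + 1 / (real q * \<bar>x - of_int p / real q\<bar>) \<le> a * (real N)\<^sup>2"
  shows "norm (weyl_sum N x) \<le> weyl_const e * sqrt a * real N powr (1 + e)"
proof -
  have "0 \<le> real N + (real N)\<^sup>2 / real q" "0 \<le> real N + 1 / (real q * \<bar>x - of_int p / real q\<bar>)"
    by simp_all
  then have "0 \<le> a * (real N)\<^sup>2"
    using a by linarith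
  then have "0 \<le> a"
    using N_pos by (simp add: zero_le_mult_iff)
  have "ln (real N) \<le> real N powr (2 * e) / (2 * e)" "1 \<le> real N powr (2 * e)"
    using assms(1) N_pos by (simp_all add: ln_powr_bound ge_one_powr_ge_zero)
  then have log: "1 + ln (real N) \<le> (1 + 1 / (2 * e)) * real N powr (2 * e)"
    by (simp add: algebra_simps)
  have "(norm (weyl_sum N x))\<^sup>2 \<le> 97 * (1 + ln (real N)) * (a * (real N)\<^sup>2)"
    using a
  proof (elim disjE conjE)
    assume "real N + (real N)\<^sup>2 / real q \<le> a * (real N)\<^sup>2"
    then show ?thesis
      using ln_N_nonneg
      by (intro order_trans[OF weyl_sum_squared_le_denominator] mult_left_mono) auto
  next
    assume "x \<noteq> of_int p / real q"
      "real N + 1 / (real q * \<bar>x - of_int p / real q\<bar>) \<le> a * (real N)\<^sup>2"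
    then show ?thesis
      using ln_N_nonneg
      by (intro order_trans[OF weyl_sum_squared_le_distance] mult_left_mono) auto
  qed
  also have "\<dots> \<le> 97 * ((1 + 1 / (2 * e)) * real N powr (2 * e)) * (a * (real N)\<^sup>2)"
    using log \<open>0 \<le> a\<close> by (intro mult_right_mono mult_left_mono) auto
  also have "\<dots> = (weyl_const e)\<^sup>2 * (sqrt a)\<^sup>2 * (real N powr (2 * e) * (real N)\<^sup>2)"
    using assms(1) \<open>0 \<le> a\<close> by (simp add: weyl_const_def)
  also have "real N powr (2 * e) * (real N)\<^sup>2 = (real N powr (1 + e))\<^sup>2"
    using N_pos by (simp add: powr_add power_mult_distrib powr_power mult.commute)
  finally have "(norm (weyl_sum N x))\<^sup>2 \<le> (weyl_const e * sqrt a * real N powr (1 + e))\<^sup>2"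
    by (simp add: power_mult_distrib)
  then show ?thesis
    by (rule power2_le_imp_le) (use assms(1) \<open>0 \<le> a\<close> in \<open>simp add: weyl_const_def\<close>)
qed

end

lemma Dirichlet_approximation_exists:
  assumes "0 < N"
  shows "\<exists>p q. Dirichlet_approximation N x p q"
proof -
  obtain p k where pk: "coprime p k" "0 < k" "k \<le> int (4 * N)"
    "\<bar>of_int k * x - of_int p\<bar> < 1 / real (4 * N)"
    using Dirichlet_approx_coprime[of "4 * N" x] assms by auto
  define q where "q = nat k"
  have q: "k = int q" "0 < q" using pk(2) by (auto simp: q_def)
  have "x - of_int p / real q = (of_int k * x - of_int p) / real q"
    using q by (simp add: field_simps)
  then have "\<bar>x - of_int p / real q\<bar> = \<bar>of_int k * x - of_int p\<bar> / real q"
    by (simp add: abs_divide)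
  also have "\<dots> \<le> 1 / real (4 * N) / real q"
    using pk(4) by (intro divide_right_mono) auto
  finally have "Dirichlet_approximation N x p q"
    using pk q by unfold_locales (auto simp: mult.commute)
  then show ?thesis by blast
qed

lemma fractions_distance_ge:
  fixes p p' :: int and q q' :: nat
  assumes "0 < q" "0 < q'" "p * int q' \<noteq> p' * int q"
  shows "1 / (real q * real q') \<le> \<bar>of_int p / real q - of_int p' / real q'\<bar>"
proof -
  have "1 \<le> \<bar>p * int q' - p' * int q\<bar>"
    using assms(3) by linarith
  then have "1 \<le> real_of_int \<bar>p * int q' - p' * int q\<bar>"
    by linarith
  then have "1 / (real q * real q')
      \<le> \<bar>of_int p * real q' - of_int p' * real q\<bar> / (real q * real q')"
    by (intro divide_right_mono) auto
  also have "\<dots> = \<bar>(of_int p * real q' - of_int p' * real q) / (real q * real q')\<bar>"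
    by (simp add: abs_divide)
  also have "(of_int p * real q' - of_int p' * real q) / (real q * real q')
      = of_int p / real q - of_int p' / real q'"
    using assms by (simp add: field_simps)
  finally show ?thesis .
qed

text \<open>
  The Dirichlet approximant \<open>p/q\<close> of \<open>x\<close> is \<open>p'/q'\<close> itself or, being distinct from it but close,
  has a comparably large denominator.
\<close>
lemma (in Dirichlet_approximation) denominator_ge_of_close_fraction:
  fixes p' :: int
  assumes "coprime p' (int q')" "0 < q'" "q' \<le> N" "\<bar>x - of_int p' / real q'\<bar> \<le> 1 / (real q')\<^sup>2"
  shows "3 * q' \<le> 4 * q"
proof (cases "p' * int q = p * int q'")
  case True
  then have "int q' dvd p' * int q" by simp
  then have "q' dvd q"
    using assms(1) by (simp add: coprime_dvd_mult_right_iff coprime_commute)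
  then show ?thesis
    using q_pos dvd_imp_le[of q' q] by simp
next
  case False
  then have "1 / (real q' * real q) \<le> \<bar>of_int p' / real q' - of_int p / real q\<bar>"
    by (intro fractions_distance_ge assms q_pos)
  also have "\<dots> \<le> 1 / (real q')\<^sup>2 + 1 / (real q * real (4 * N))"
    using assms(4) approx by linarith
  also have "1 / (real q * real (4 * N)) \<le> 1/4 * (1 / (real q' * real q))"
    using q_pos assms(2,3) by (simp add: divide_simps)
  finally have "1 / (real q' * real q) \<le> 1 / (real q')\<^sup>2 + 1/4 * (1 / (real q' * real q))"
    by simp
  then have "3 * real q' \<le> 4 * real q"
    using assms(2) q_pos by (simp add: field_simps power2_eq_square)
  then show ?thesis by linarith
qed

theorem weyl_inequality:
  assumes "0 < e" "coprime p (int q)" "0 < q" "q \<le> N" "\<bar>x - of_int p / real q\<bar> \<le> 1 / (real q)\<^sup>2"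
  shows "norm (weyl_sum N x) \<le> weyl_const e * sqrt (3 / real q) * real N powr (1 + e)"
proof -
  obtain p' q' where "Dirichlet_approximation N x p' q'"
    using Dirichlet_approximation_exists assms(3,4) by (metis order_less_le_trans)
  then interpret Dirichlet_approximation N x p' q' .
  have "3 * real q \<le> 4 * real q'"
    using denominator_ge_of_close_fraction[OF assms(2-5)] by linarith
  then have "1 / real q' \<le> 4 / (3 * real q)"
    using assms(3) q_pos by (simp add: field_simps)
  also have "\<dots> \<le> 2 / real q"
    using assms(3) by (simp add: field_simps)
  finally have "(real N)\<^sup>2 * (1 / real q') \<le> (real N)\<^sup>2 * (2 / real q)"
    by (intro mult_left_mono) auto
  moreover have "real N \<le> (real N)\<^sup>2 * (1 / real q)"
    using assms(3,4) by (simp add: field_simps power2_eq_square)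
  ultimately have "real N + (real N)\<^sup>2 / real q' \<le> 3 / real q * (real N)\<^sup>2"
    by simp
  then show ?thesis
    using norm_weyl_sum_le[OF assms(1)] by blast
qed


section \<open>Weyl sums near Diophantine points\<close>

definition Diophantine_condition :: "real \<Rightarrow> real \<Rightarrow> real \<Rightarrow> bool" where
  "Diophantine_condition c \<mu> x \<longleftrightarrow>
    (\<forall>p q. coprime p (int q) \<longrightarrow> 0 < q \<longrightarrow> c * real q powr (- \<mu>) \<le> \<bar>x - of_int p / real q\<bar>)"

lemma inverse_denominator_le:
  fixes c \<eta> \<mu> :: real
  assumes "0 < q" "0 < c" "0 < \<mu>" "c * real q powr (- \<mu>) \<le> \<eta>"
  shows "1 / real q \<le> (1 / c) powr (1 / \<mu>) * \<eta> powr (1 / \<mu>)"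
proof -
  have "1 / real q = (real q powr (- \<mu>)) powr (1 / \<mu>)"
    using assms by (simp add: powr_powr powr_neg_one)
  also have "\<dots> \<le> (1 / c * \<eta>) powr (1 / \<mu>)"
    using assms by (intro powr_mono2) (auto simp: field_simps)
  finally show ?thesis
    by (simp only: powr_mult)
qed

lemma inverse_distance_le:
  fixes c \<delta> \<mu> B :: real
  assumes "0 < q" "0 < c" "1 \<le> \<mu>" "c * real q powr (- \<mu>) \<le> \<delta>" "real q \<le> B powr (1 / \<mu>)"
  shows "1 / (real q * \<delta>) \<le> 1 / c * B powr (1 - 1 / \<mu>)"
proof -
  have "0 < c * real q powr (- \<mu>)"
    using assms(1,2) by simp
  moreover from this have "0 < \<delta>"
    using assms(4) by linarith
  ultimately have "1 / (real q * \<delta>) \<le> 1 / (real q * (c * real q powr (- \<mu>)))"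
    using assms by (intro divide_left_mono mult_left_mono mult_pos_pos) auto
  also have "\<dots> = 1 / c * real q powr (\<mu> - 1)"
    using assms by (simp add: powr_diff powr_minus_divide)
  also have "\<dots> \<le> 1 / c * (B powr (1 / \<mu>)) powr (\<mu> - 1)"
    using assms by (intro mult_left_mono powr_mono2) auto
  also have "(B powr (1 / \<mu>)) powr (\<mu> - 1) = B powr (1 - 1 / \<mu>)"
    using assms by (simp add: powr_powr right_diff_distrib)
  finally show ?thesis .
qed

text \<open>
  The Diophantine condition keeps \<open>z\<close> away from the approximant \<open>p/q\<close> of \<open>x\<close>: either \<open>\<eta>\<close> is large
  enough to bridge that distance, which bounds \<open>q\<close> from below, or \<open>x\<close> is away from \<open>p/q\<close> as well.
  In the latter case the two bounds balance at \<open>q = B\<^bsup>1/\<mu>\<^esup>\<close>.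
\<close>
lemma (in Dirichlet_approximation) approximant_near_Diophantine:
  fixes \<eta> :: real
  assumes \<mu>: "1 \<le> \<mu>" and c: "0 < c" and z: "Diophantine_condition c \<mu> z" "\<bar>x - z\<bar> \<le> \<eta>"
    and B: "0 < B" "1 \<le> \<eta> * B"
  defines "K \<equiv> 1 + (2 / c) powr (1 / \<mu>) + 2 / c" and "w \<equiv> \<eta> powr (1 / \<mu>)"
  shows "1 / real q \<le> K * w \<or>
    x \<noteq> of_int p / real q \<and> 1 / (real q * \<bar>x - of_int p / real q\<bar>) \<le> K * B powr (1 - 1 / \<mu>)"
proof -
  have K: "1 \<le> K" "(2 / c) powr (1 / \<mu>) \<le> K" "2 / c \<le> K"
    using c by (simp_all add: K_def)
  define r where "r = c / 2 * real q powr (- \<mu>)"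
  have "0 < r"
    using c q_pos by (simp add: r_def)
  have "2 * r \<le> \<bar>z - of_int p / real q\<bar>"
    using z(1) coprime q_pos by (simp add: Diophantine_condition_def r_def)
  then consider (wide) "r \<le> \<eta>" | (large_denominator) "B powr (1 / \<mu>) \<le> real q"
    | (distant) "real q < B powr (1 / \<mu>)" "r \<le> \<bar>x - of_int p / real q\<bar>"
    using z(2) by atomize_elim linarith
  then show ?thesis
  proof cases
    case wide
    then have "1 / real q \<le> (2 / c) powr (1 / \<mu>) * w"
      using inverse_denominator_le[of q "c / 2"] c \<mu> q_pos by (simp add: w_def r_def)
    also have "\<dots> \<le> K * w"
      using K by (intro mult_right_mono) (auto simp: w_def)
    finally show ?thesis ..
  next
    case large_denominator
    then have "1 / real q \<le> 1 / B powr (1 / \<mu>)"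
      using B(1) by (intro divide_left_mono) (auto simp: q_pos)
    also have "\<dots> = (1 / B) powr (1 / \<mu>)"
      by (simp add: powr_divide)
    also have "\<dots> \<le> 1 * w"
      unfolding w_def mult_1 using B \<mu> by (intro powr_mono2) (auto simp: divide_le_eq)
    also have "\<dots> \<le> K * w"
      using K by (intro mult_right_mono) (auto simp: w_def)
    finally show ?thesis ..
  next
    case distant
    then have "1 / (real q * \<bar>x - of_int p / real q\<bar>) \<le> 2 / c * B powr (1 - 1 / \<mu>)"
      using inverse_distance_le[of q "c / 2"] c \<mu> q_pos by (simp add: r_def)
    also have "\<dots> \<le> K * B powr (1 - 1 / \<mu>)"
      using K by (intro mult_right_mono) auto
    finally show ?thesis
      using distant(2) \<open>0 < r\<close> by auto
  qed
qed

lemma weyl_sum_near_Diophantine: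
  fixes c e \<eta> \<mu> :: real
  assumes e: "0 < e" and \<mu>: "2 \<le> \<mu>" and c: "0 < c"
    and z: "Diophantine_condition c \<mu> z" "\<bar>x - z\<bar> \<le> \<eta>" and \<eta>: "1 \<le> \<eta> * (real N)\<^sup>2"
  shows "norm (weyl_sum N x)
    \<le> weyl_const e * sqrt ((2 + (2 / c) powr (1 / \<mu>) + 2 / c) * \<eta> powr (1 / \<mu>))
      * real N powr (1 + e)"
proof -
  have N: "0 < N"
    using \<eta> by (cases N) auto
  then obtain p q where "Dirichlet_approximation N x p q"
    using Dirichlet_approximation_exists by blast
  then interpret Dirichlet_approximation N x p q .
  define B K w where "B = (real N)\<^sup>2" and "K = 1 + (2 / c) powr (1 / \<mu>) + 2 / c"
    and "w = \<eta> powr (1 / \<mu>)"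
  have B: "1 \<le> B" "1 \<le> \<eta> * B" "sqrt B = real N"
    using N \<eta> by (simp_all add: B_def)
  have "0 \<le> K"
    using c by (simp add: K_def)
  have "(1 / B) powr (1 / \<mu>) \<le> w"
    unfolding w_def using B \<mu> by (intro powr_mono2) (auto simp: divide_le_eq)
  then have "(1 / B) powr (1 / \<mu>) * B \<le> w * B"
    using B(1) by (intro mult_right_mono) auto
  then have B_powr: "B powr (1 - 1 / \<mu>) \<le> w * B"
    using B(1) by (simp add: powr_diff powr_divide)
  have "real N = B powr (1/2)"
    using B by (simp add: powr_half_sqrt)
  also have "\<dots> \<le> B powr (1 - 1 / \<mu>)"
    using B(1) \<mu> by (intro powr_mono) (auto simp: field_simps)
  finally have N_le: "real N \<le> w * B"
    using B_powr by linarith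
  have "1 / real q \<le> K * w \<or>
      x \<noteq> of_int p / real q \<and> 1 / (real q * \<bar>x - of_int p / real q\<bar>) \<le> K * B powr (1 - 1 / \<mu>)"
    unfolding K_def w_def using \<mu> B by (intro approximant_near_Diophantine[OF _ c z]) auto
  then have "B / real q \<le> K * (w * B) \<or>
      x \<noteq> of_int p / real q \<and> 1 / (real q * \<bar>x - of_int p / real q\<bar>) \<le> K * (w * B)"
    using mult_right_mono[of "1 / real q" "K * w" B] B(1) mult_left_mono[OF B_powr \<open>0 \<le> K\<close>] by auto
  then have "real N + B / real q \<le> (1 + K) * w * B \<or>
      x \<noteq> of_int p / real q \<and> real N + 1 / (real q * \<bar>x - of_int p / real q\<bar>) \<le> (1 + K) * w * B"
    using N_le by (auto simp: algebra_simps)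
  then have "norm (weyl_sum N x) \<le> weyl_const e * sqrt ((1 + K) * w) * real N powr (1 + e)"
    unfolding B_def by (rule norm_weyl_sum_le[OF e])
  then show ?thesis
    by (simp add: K_def w_def add.assoc)
qed


section \<open>Increments of the Gauss series\<close>

lemma sum_by_parts:
  fixes u :: "nat \<Rightarrow> 'a :: real_vector" and b :: "nat \<Rightarrow> real"
  assumes "K \<le> M"
  shows "(\<Sum>k=Suc K..M. b k *\<^sub>R u k)
    = b (Suc M) *\<^sub>R (\<Sum>k=1..M. u k) - b (Suc K) *\<^sub>R (\<Sum>k=1..K. u k)
      + (\<Sum>k=Suc K..M. (b k - b (Suc k)) *\<^sub>R (\<Sum>j=1..k. u j))"
  using assms
proof (induction M rule: dec_induct)
  case (step n)
  then show ?case
    by (simp add: scaleR_add_right scaleR_diff_left algebra_simps)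
qed simp

lemma powr_neg_diff_le:
  fixes \<sigma> t :: real
  assumes "0 < \<sigma>" "0 < t"
  shows "t powr (- \<sigma>) - (t + 1) powr (- \<sigma>) \<le> \<sigma> * t powr (- \<sigma> - 1)"
    and "\<sigma> * (t + 1) powr (- \<sigma> - 1) \<le> t powr (- \<sigma>) - (t + 1) powr (- \<sigma>)"
proof -
  have "\<exists>z>t. z < t + 1 \<and>
      (t + 1) powr (- \<sigma>) - t powr (- \<sigma>) = (t + 1 - t) * (- \<sigma> * z powr (- \<sigma> - 1))"
    using assms by (intro MVT2) (auto intro!: derivative_eq_intros)
  then obtain z where z: "t < z" "z < t + 1"
    "t powr (- \<sigma>) - (t + 1) powr (- \<sigma>) = \<sigma> * z powr (- \<sigma> - 1)"
    by auto
  show "t powr (- \<sigma>) - (t + 1) powr (- \<sigma>) \<le> \<sigma> * t powr (- \<sigma> - 1)"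
    unfolding z(3) using z assms by (intro mult_left_mono powr_mono2') auto
  show "\<sigma> * (t + 1) powr (- \<sigma> - 1) \<le> t powr (- \<sigma>) - (t + 1) powr (- \<sigma>)"
    unfolding z(3) using z assms by (intro mult_left_mono powr_mono2') auto
qed

lemma sum_powr_tail_le:
  assumes "0 < \<sigma>" "0 < K" "K \<le> M"
  shows "(\<Sum>k=Suc K..M. real k powr (- \<sigma> - 1)) \<le> real K powr (- \<sigma>) / \<sigma>"
proof -
  have "\<sigma> * (\<Sum>k=Suc K..M. real k powr (- \<sigma> - 1)) \<le> real K powr (- \<sigma>) - real M powr (- \<sigma>)"
    using assms(3)
  proof (induction M rule: dec_induct)
    case (step n)
    then show ?case
      using powr_neg_diff_le(2)[OF assms(1), of "real n"] assms(2)
      by (simp add: distrib_left add.commute)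
  qed simp
  also have "\<dots> \<le> real K powr (- \<sigma>)"
    by simp
  finally show ?thesis
    using assms(1) by (simp add: field_simps)
qed

lemma norm_sum_powr_differences_le:
  fixes S :: "nat \<Rightarrow> 'a :: real_normed_vector"
  assumes "0 \<le> \<theta>" "\<theta> < \<sigma>" "0 < K" "K \<le> M" "0 \<le> A"
    and S: "\<And>k. K \<le> k \<Longrightarrow> norm (S k) \<le> A * real k powr \<theta>"
  shows "norm (\<Sum>k=Suc K..M. (real k powr (- \<sigma>) - real (Suc k) powr (- \<sigma>)) *\<^sub>R S k)
    \<le> \<sigma> / (\<sigma> - \<theta>) * A * real K powr (\<theta> - \<sigma>)"
proof -
  have "norm (\<Sum>k=Suc K..M. (real k powr (- \<sigma>) - real (Suc k) powr (- \<sigma>)) *\<^sub>R S k)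
      \<le> (\<Sum>k=Suc K..M. \<sigma> * A * real k powr (- (\<sigma> - \<theta>) - 1))"
  proof (rule sum_norm_le)
    fix k assume "k \<in> {Suc K..M}"
    then have k: "K \<le> k" "0 < k" by auto
    define d where "d = real k powr (- \<sigma>) - real (Suc k) powr (- \<sigma>)"
    have "0 \<le> d" "d \<le> \<sigma> * real k powr (- \<sigma> - 1)"
      using powr_neg_diff_le(1)[of \<sigma> "real k"] k assms
      by (auto simp: d_def add.commute intro: powr_mono2')
    then have "norm (d *\<^sub>R S k) \<le> (\<sigma> * real k powr (- \<sigma> - 1)) * (A * real k powr \<theta>)"
      unfolding norm_scaleR using S[OF k(1)] by (intro mult_mono) auto
    also have "\<dots> = \<sigma> * A * real k powr (- (\<sigma> - \<theta>) - 1)"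
      by (simp add: algebra_simps flip: powr_add)
    finally show "norm ((real k powr (- \<sigma>) - real (Suc k) powr (- \<sigma>)) *\<^sub>R S k)
        \<le> \<sigma> * A * real k powr (- (\<sigma> - \<theta>) - 1)"
      by (simp add: d_def)
  qed
  also have "\<dots> \<le> \<sigma> * A * (real K powr (- (\<sigma> - \<theta>)) / (\<sigma> - \<theta>))"
    unfolding sum_distrib_left[symmetric] using assms
    by (intro mult_left_mono sum_powr_tail_le) auto
  finally show ?thesis
    by simp
qed

lemma norm_weighted_tail_le:
  fixes u :: "nat \<Rightarrow> 'a :: real_normed_vector"
  assumes "0 \<le> \<theta>" "\<theta> < \<sigma>" "0 < K" "K \<le> M" "0 \<le> A"
    and partial_sums: "\<And>k. K \<le> k \<Longrightarrow> norm (\<Sum>j=1..k. u j) \<le> A * real k powr \<theta>"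
  shows "norm (\<Sum>k=Suc K..M. real k powr (- \<sigma>) *\<^sub>R u k)
    \<le> (2 + \<sigma> / (\<sigma> - \<theta>)) * A * real K powr (\<theta> - \<sigma>)"
proof -
  define S where "S k = (\<Sum>j=1..k. u j)" for k
  have boundary: "norm (real (Suc k) powr (- \<sigma>) *\<^sub>R S k) \<le> A * real K powr (\<theta> - \<sigma>)" if "K \<le> k" for k
  proof -
    have "norm (real (Suc k) powr (- \<sigma>) *\<^sub>R S k) \<le> real k powr (- \<sigma>) * (A * real k powr \<theta>)"
      unfolding norm_scaleR S_def using assms that partial_sums[OF that]
      by (intro mult_mono) (auto intro: powr_mono2')
    also have "\<dots> = A * real k powr (\<theta> - \<sigma>)"
      by (simp add: powr_diff powr_minus_divide)
    also have "\<dots> \<le> A * real K powr (\<theta> - \<sigma>)"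
      using assms that by (intro mult_left_mono powr_mono2') auto
    finally show ?thesis .
  qed
  have "norm (\<Sum>k=Suc K..M. real k powr (- \<sigma>) *\<^sub>R u k)
      = norm (real (Suc M) powr (- \<sigma>) *\<^sub>R S M - real (Suc K) powr (- \<sigma>) *\<^sub>R S K
        + (\<Sum>k=Suc K..M. (real k powr (- \<sigma>) - real (Suc k) powr (- \<sigma>)) *\<^sub>R S k))"
    unfolding S_def by (subst sum_by_parts[OF assms(4)]) (rule refl)
  also have "\<dots> \<le> A * real K powr (\<theta> - \<sigma>) + A * real K powr (\<theta> - \<sigma>)
      + \<sigma> / (\<sigma> - \<theta>) * A * real K powr (\<theta> - \<sigma>)"
    using assms(4) partial_sums
    by (intro norm_triangle_mono norm_triangle_le_diff add_mono boundary
        norm_sum_powr_differences_le assms(1-5)) (auto simp: S_def)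
  also have "\<dots> = (2 + \<sigma> / (\<sigma> - \<theta>)) * A * real K powr (\<theta> - \<sigma>)"
    by (simp add: algebra_simps)
  finally show ?thesis .
qed

definition gauss_term :: "real \<Rightarrow> nat \<Rightarrow> complex" where
  "gauss_term x k = cis2pi ((real k)\<^sup>2 * x) / (of_nat k)\<^sup>2"

definition gauss_partial_sum :: "nat \<Rightarrow> real \<Rightarrow> complex" where
  "gauss_partial_sum N x = (\<Sum>k=1..N. gauss_term x k)"

definition gauss_series :: "real \<Rightarrow> complex" where
  "gauss_series x = (\<Sum>n. gauss_term x (Suc n))"

lemma norm_gauss_term: "norm (gauss_term x k) = 1 / (real k)\<^sup>2"
  by (simp add: gauss_term_def norm_divide norm_power)

lemma summable_norm_gauss_term: "summable (\<lambda>n. norm (gauss_term x (Suc n)))"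
  unfolding norm_gauss_term
  using inverse_power_summable[of 2, where ?'a = real]
  by (subst summable_Suc_iff) (simp add: inverse_eq_divide)

lemma gauss_partial_sum_LIMSEQ: "(\<lambda>N. gauss_partial_sum N x) \<longlonglongrightarrow> gauss_series x"
proof -
  have "gauss_partial_sum N x = (\<Sum>n<N. gauss_term x (Suc n))" for N
    unfolding gauss_partial_sum_def
    by (rule sum.reindex_bij_witness[of _ Suc "\<lambda>k. k - 1"]) auto
  then show ?thesis
    unfolding gauss_series_def
    using summable_LIMSEQ[OF summable_norm_cancel[OF summable_norm_gauss_term]] by simp
qed

lemma gauss_series_tail_le:
  assumes "0 < e" "e < 1" "0 < K" "0 \<le> A"
    and weyl: "\<And>k. K \<le> k \<Longrightarrow> norm (weyl_sum k x) \<le> A * real k powr (1 + e)"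
  shows "norm (gauss_series x - gauss_partial_sum K x) \<le> 4 / (1 - e) * A * real K powr (e - 1)"
proof (rule tendsto_upperbound)
  show "(\<lambda>M. norm (gauss_partial_sum M x - gauss_partial_sum K x))
      \<longlonglongrightarrow> norm (gauss_series x - gauss_partial_sum K x)"
    by (intro tendsto_intros gauss_partial_sum_LIMSEQ)
  show "\<forall>\<^sub>F M in sequentially.
      norm (gauss_partial_sum M x - gauss_partial_sum K x) \<le> 4 / (1 - e) * A * real K powr (e - 1)"
    using eventually_ge_at_top[of K]
  proof eventually_elim
    case (elim M)
    have "gauss_partial_sum M x - gauss_partial_sum K x = (\<Sum>k=Suc K..M. gauss_term x k)"
      using sum.ub_add_nat[of 1 K "gauss_term x" "M - K"] elim by (simp add: gauss_partial_sum_def)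
    also have "\<dots> = (\<Sum>k=Suc K..M. real k powr (- 2) *\<^sub>R cis2pi ((real k)\<^sup>2 * x))"
      by (intro sum.cong) (auto simp: gauss_term_def powr_minus_divide scaleR_conv_of_real)
    also have "norm \<dots> \<le> (2 + 2 / (2 - (1 + e))) * A * real K powr (1 + e - 2)"
      using assms elim by (intro norm_weighted_tail_le) (auto simp: weyl_sum_def)
    also have "\<dots> \<le> 4 / (1 - e) * A * real K powr (e - 1)"
      using assms by (intro mult_mono) (auto simp: field_simps)
    finally show ?case .
  qed
qed simp

lemma gauss_partial_sum_increment_le:
  assumes weyl: "\<And>y. \<bar>y - x\<bar> \<le> \<bar>h\<bar> \<Longrightarrow> norm (weyl_sum K y) \<le> B"
  shows "norm (gauss_partial_sum K (x + h) - gauss_partial_sum K x) \<le> 2 * pi * B * \<bar>h\<bar>"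
proof -
  have "((\<lambda>y. gauss_term y k) has_vector_derivative 2 * pi * \<i> * cis2pi ((real k)\<^sup>2 * y))
      (at y within S)" if "k \<in> {1..K}" for k y S
    unfolding has_vector_derivative_def gauss_term_def cis2pi_def using that
    by (auto intro!: derivative_eq_intros simp: scaleR_conv_of_real field_simps power2_eq_square)
  then have "(gauss_partial_sum K has_vector_derivative 2 * pi * \<i> * weyl_sum K y)
      (at y within S)" for y S
    unfolding gauss_partial_sum_def weyl_sum_def sum_distrib_left
    by (rule has_vector_derivative_sum)
  then have "(gauss_partial_sum K has_derivative (\<lambda>t. t *\<^sub>R (2 * pi * \<i> * weyl_sum K y)))
      (at y within S)" for y S
    by (simp add: has_vector_derivative_def)
  then have "norm (gauss_partial_sum K (x + h) - gauss_partial_sum K x)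
      \<le> 2 * pi * B * norm (x + h - x)"
  proof (rule differentiable_bound[OF convex_closed_segment])
    fix y assume "y \<in> closed_segment x (x + h)"
    then have "\<bar>y - x\<bar> \<le> \<bar>h\<bar>"
      by (auto simp: closed_segment_eq_real_ivl split: if_splits)
    then have "2 * pi * \<bar>t\<bar> * norm (weyl_sum K y) \<le> 2 * pi * \<bar>t\<bar> * B" for t
      by (intro mult_left_mono weyl) auto
    then show "onorm (\<lambda>t. t *\<^sub>R (2 * pi * \<i> * weyl_sum K y)) \<le> 2 * pi * B"
      by (intro onorm_le) (simp add: norm_mult mult_ac)
  qed auto
  then show ?thesis by simp
qed

lemma exists_nat_square_cutoff:
  fixes h :: real
  assumes "0 < h" "h \<le> 1"
  shows "\<exists>K::nat. 1 \<le> h * (real K)\<^sup>2 \<and> h * (real K)\<^sup>2 \<le> 4"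
proof -
  define H K where "H = 1 / sqrt h" and "K = nat \<lceil>H\<rceil>"
  have H: "1 \<le> H" "h * H\<^sup>2 = 1"
    using assms by (simp_all add: H_def power_divide)
  then have K: "H \<le> real K" "real K \<le> 2 * H"
    unfolding K_def by linarith+
  have "h * H\<^sup>2 \<le> h * (real K)\<^sup>2" "h * (real K)\<^sup>2 \<le> h * (2 * H)\<^sup>2"
    using assms H K by (intro mult_left_mono power_mono; simp)+
  then show ?thesis
    using H(2) by (auto simp: power_mult_distrib)
qed

lemma powr_le_of_square_ge:
  fixes e h t :: real
  assumes "0 < h" "0 < t" "e \<le> 1" "1 \<le> h * t\<^sup>2"
  shows "t powr (e - 1) \<le> h powr ((1 - e) / 2)"
proof -
  have "(t\<^sup>2) powr ((e - 1) / 2) \<le> (1 / h) powr ((e - 1) / 2)"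
    using assms by (intro powr_mono2') (auto simp: field_simps)
  also have "(t\<^sup>2) powr ((e - 1) / 2) = t powr (e - 1)"
    using assms(2)
    by (simp add: powr_powr flip: powr_numeral del: right_diff_distrib_numeral)
  finally show ?thesis
    by (simp add: powr_divide minus_divide_left flip: powr_minus_divide)
qed

lemma gauss_series_increment_le_cutoff:
  assumes e: "0 < e" "e < 1" and K: "0 < K" and A: "0 \<le> A"
    and weyl: "\<And>k y. K \<le> k \<Longrightarrow> \<bar>y - x\<bar> \<le> \<bar>h\<bar> \<Longrightarrow> norm (weyl_sum k y) \<le> A * real k powr (1 + e)"
  shows "norm (gauss_series (x + h) - gauss_series x)
    \<le> 8 / (1 - e) * A * real K powr (e - 1) + 2 * pi * A * real K powr (1 + e) * \<bar>h\<bar>"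
proof -
  define T where "T = 4 / (1 - e) * A * real K powr (e - 1)"
  have tail: "norm (gauss_series y - gauss_partial_sum K y) \<le> T" if "\<bar>y - x\<bar> \<le> \<bar>h\<bar>" for y
    unfolding T_def using that by (intro gauss_series_tail_le e K A weyl)
  have low: "norm (gauss_partial_sum K (x + h) - gauss_partial_sum K x)
      \<le> 2 * pi * (A * real K powr (1 + e)) * \<bar>h\<bar>"
    by (intro gauss_partial_sum_increment_le weyl order_refl)
  have "norm (gauss_series (x + h) - gauss_series x)
      = norm ((gauss_series (x + h) - gauss_partial_sum K (x + h))
        + (gauss_partial_sum K (x + h) - gauss_partial_sum K x)
        - (gauss_series x - gauss_partial_sum K x))"
    by simp
  also have "\<dots> \<le> T + 2 * pi * (A * real K powr (1 + e)) * \<bar>h\<bar> + T"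
    by (intro norm_triangle_le_diff norm_triangle_le add_mono tail low) auto
  finally show ?thesis
    by (simp add: T_def mult.assoc)
qed

lemma gauss_series_increment_le:
  assumes e: "0 < e" "e < 1" and A: "0 \<le> A" and h: "\<bar>h\<bar> \<le> 1"
    and weyl: "\<And>k y. 1 \<le> \<bar>h\<bar> * (real k)\<^sup>2 \<Longrightarrow> \<bar>y - x\<bar> \<le> \<bar>h\<bar> \<Longrightarrow>
        norm (weyl_sum k y) \<le> A * real k powr (1 + e)"
  shows "norm (gauss_series (x + h) - gauss_series x) \<le> 40 / (1 - e) * A * \<bar>h\<bar> powr ((1 - e) / 2)"
proof (cases "h = 0")
  case False
  then obtain K where K: "1 \<le> \<bar>h\<bar> * (real K)\<^sup>2" "\<bar>h\<bar> * (real K)\<^sup>2 \<le> 4"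
    using exists_nat_square_cutoff[of "\<bar>h\<bar>"] h by auto
  then have "0 < K"
    by (cases K) auto
  define w where "w = \<bar>h\<bar> powr ((1 - e) / 2)"
  have K_powr: "real K powr (e - 1) \<le> w"
    unfolding w_def using False \<open>0 < K\<close> K(1) e by (intro powr_le_of_square_ge) auto
  have "norm (gauss_series (x + h) - gauss_series x)
      \<le> 8 / (1 - e) * A * real K powr (e - 1) + 2 * pi * A * real K powr (1 + e) * \<bar>h\<bar>"
  proof (rule gauss_series_increment_le_cutoff[OF e \<open>0 < K\<close> A weyl])
    fix k assume "K \<le> k"
    then have "\<bar>h\<bar> * (real K)\<^sup>2 \<le> \<bar>h\<bar> * (real k)\<^sup>2"
      by (intro mult_left_mono power_mono) auto
    then show "1 \<le> \<bar>h\<bar> * (real k)\<^sup>2"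
      using K(1) by linarith
  qed
  also have "2 * pi * A * real K powr (1 + e) * \<bar>h\<bar>
      = 2 * pi * A * (\<bar>h\<bar> * (real K)\<^sup>2 * real K powr (e - 1))"
    using \<open>0 < K\<close> by (simp add: powr_add powr_diff power2_eq_square)
  also have "8 / (1 - e) * A * real K powr (e - 1) + \<dots> \<le> 8 / (1 - e) * A * w + 2 * 4 * A * (4 * w)"
    using K(2) K_powr A e pi_less_4
    by (intro add_mono mult_mono mult_left_mono mult_nonneg_nonneg) auto
  also have "\<dots> \<le> 40 / (1 - e) * A * w"
  proof -
    have "A * w * 1 \<le> A * w * (1 / (1 - e))"
      using A e by (intro mult_left_mono) (auto simp: w_def)
    then show ?thesis by simp
  qed
  finally show ?thesis
    by (simp add: w_def)
qed simp

theorem gauss_series_near_rational: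
  assumes "0 < e" "e < 1"
  shows "\<exists>C\<ge>0. \<forall>p q h. coprime p (int q) \<longrightarrow> 0 < q \<longrightarrow> \<bar>h\<bar> \<le> 1 / (real q)\<^sup>2 \<longrightarrow>
    norm (gauss_series (of_int p / real q + h) - gauss_series (of_int p / real q))
      \<le> C * real q powr (- 1/2) * \<bar>h\<bar> powr ((1 - e) / 2)"
proof (intro exI conjI allI impI)
  define C where "C = 40 / (1 - e) * weyl_const e * sqrt 3"
  show "0 \<le> C"
    using assms by (simp add: C_def weyl_const_def)
  fix p :: int and q :: nat and h :: real
  assume pq: "coprime p (int q)" "0 < q" and h: "\<bar>h\<bar> \<le> 1 / (real q)\<^sup>2"
  have "norm (gauss_series (of_int p / real q + h) - gauss_series (of_int p / real q))
      \<le> 40 / (1 - e) * (weyl_const e * sqrt (3 / real q)) * \<bar>h\<bar> powr ((1 - e) / 2)"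
  proof (rule gauss_series_increment_le[OF assms])
    have "1 / (real q)\<^sup>2 \<le> 1"
      using pq(2) by simp
    then show "\<bar>h\<bar> \<le> 1"
      using h by linarith
  next
    fix k y assume k: "1 \<le> \<bar>h\<bar> * (real k)\<^sup>2" and y: "\<bar>y - of_int p / real q\<bar> \<le> \<bar>h\<bar>"
    have "1 \<le> 1 / (real q)\<^sup>2 * (real k)\<^sup>2"
      using k mult_right_mono[OF h zero_le_power2] by (rule order_trans)
    then have "(real q)\<^sup>2 \<le> (real k)\<^sup>2"
      using pq(2) by simp
    then have "q \<le> k"
      by (simp add: power2_le_iff_abs_le)
    then show "norm (weyl_sum k y) \<le> weyl_const e * sqrt (3 / real q) * real k powr (1 + e)"
      using y h by (intro weyl_inequality[OF assms(1) pq]) auto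
  qed (use assms in \<open>simp add: weyl_const_def\<close>)
  also have "sqrt (3 / real q) = sqrt 3 * real q powr (- 1/2)"
    using pq(2) by (simp add: real_sqrt_divide powr_minus_divide powr_half_sqrt)
  finally show "norm (gauss_series (of_int p / real q + h) - gauss_series (of_int p / real q))
      \<le> C * real q powr (- 1/2) * \<bar>h\<bar> powr ((1 - e) / 2)"
    by (simp add: C_def mult_ac)
qed

lemma gauss_series_close_to_rational:
  assumes e: "0 < e" "e < 1" and \<mu>: "2 \<le> \<mu>"
  shows "\<exists>C\<ge>0. \<forall>p q x. coprime p (int q) \<longrightarrow> 0 < q \<longrightarrow>
    \<bar>x - of_int p / real q\<bar> \<le> real q powr (- \<mu>) \<longrightarrow>
    norm (gauss_series x - gauss_series (of_int p / real q))
      \<le> C * real q powr (- ((1 + \<mu> * (1 - e)) / 2))"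
proof -
  obtain C where C: "0 \<le> C" "\<And>p q h. coprime p (int q) \<Longrightarrow> 0 < q \<Longrightarrow> \<bar>h\<bar> \<le> 1 / (real q)\<^sup>2 \<Longrightarrow>
      norm (gauss_series (of_int p / real q + h) - gauss_series (of_int p / real q))
        \<le> C * real q powr (- 1/2) * \<bar>h\<bar> powr ((1 - e) / 2)"
    using gauss_series_near_rational[OF e] by metis
  have "norm (gauss_series x - gauss_series (of_int p / real q))
      \<le> C * real q powr (- ((1 + \<mu> * (1 - e)) / 2))"
    if pq: "coprime p (int q)" "0 < q" and x: "\<bar>x - of_int p / real q\<bar> \<le> real q powr (- \<mu>)"
    for p q x
  proof -
    define h where "h = x - of_int p / real q"
    have "real q powr (- \<mu>) \<le> real q powr (- 2)"
      using \<mu> pq(2) by (intro powr_mono) auto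
    then have "\<bar>h\<bar> \<le> 1 / (real q)\<^sup>2"
      using x pq(2) by (simp add: h_def powr_minus_divide)
    then have "norm (gauss_series (of_int p / real q + h) - gauss_series (of_int p / real q))
        \<le> C * real q powr (- 1/2) * \<bar>h\<bar> powr ((1 - e) / 2)"
      by (rule C(2)[OF pq])
    also have "\<dots> \<le> C * real q powr (- 1/2) * (real q powr (- \<mu>)) powr ((1 - e) / 2)"
      using x e C(1) by (intro mult_left_mono powr_mono2) (auto simp: h_def)
    also have "\<dots> = C * real q powr (- 1/2 + - \<mu> * ((1 - e) / 2))"
      unfolding powr_powr powr_add by simp
    also have "- 1/2 + - \<mu> * ((1 - e) / 2) = - ((1 + \<mu> * (1 - e)) / 2)"
      by (simp add: field_simps)
    finally show ?thesis
      by (simp add: h_def)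
  qed
  with C(1) show ?thesis by blast
qed

theorem gauss_series_Diophantine:
  assumes "0 < e" "e < 1" "2 \<le> \<mu>" "0 < c" "Diophantine_condition c \<mu> x"
  shows "\<exists>C\<ge>0. \<forall>h. \<bar>h\<bar> \<le> 1 \<longrightarrow>
    norm (gauss_series (x + h) - gauss_series x) \<le> C * \<bar>h\<bar> powr (1/2 + 1 / (2 * \<mu>) - e / 2)"
proof (intro exI conjI allI impI)
  define M where "M = 2 + (2 / c) powr (1 / \<mu>) + 2 / c"
  have "0 \<le> M"
    using assms by (simp add: M_def)
  define C where "C = 40 / (1 - e) * weyl_const e * sqrt M"
  show "0 \<le> C"
    using assms \<open>0 \<le> M\<close> by (simp add: C_def weyl_const_def)
  fix h :: real assume h: "\<bar>h\<bar> \<le> 1"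
  have "norm (gauss_series (x + h) - gauss_series x)
      \<le> 40 / (1 - e) * (weyl_const e * sqrt (M * \<bar>h\<bar> powr (1 / \<mu>))) * \<bar>h\<bar> powr ((1 - e) / 2)"
  proof (rule gauss_series_increment_le[OF assms(1,2) _ h])
    fix k y assume "1 \<le> \<bar>h\<bar> * (real k)\<^sup>2" "\<bar>y - x\<bar> \<le> \<bar>h\<bar>"
    then show "norm (weyl_sum k y)
        \<le> weyl_const e * sqrt (M * \<bar>h\<bar> powr (1 / \<mu>)) * real k powr (1 + e)"
      unfolding M_def by (intro weyl_sum_near_Diophantine[OF assms(1,3-5)])
  qed (use assms \<open>0 \<le> M\<close> in \<open>simp add: weyl_const_def\<close>)
  also have "sqrt (M * \<bar>h\<bar> powr (1 / \<mu>)) = sqrt M * \<bar>h\<bar> powr (1 / (2 * \<mu>))"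
    by (simp add: real_sqrt_mult powr_powr mult.commute flip: powr_half_sqrt)
  also have "40 / (1 - e) * (weyl_const e * (sqrt M * \<bar>h\<bar> powr (1 / (2 * \<mu>))))
        * \<bar>h\<bar> powr ((1 - e) / 2)
      = C * \<bar>h\<bar> powr (1 / (2 * \<mu>) + (1 - e) / 2)"
    by (simp add: C_def powr_add)
  also have "1 / (2 * \<mu>) + (1 - e) / 2 = 1/2 + 1 / (2 * \<mu>) - e / 2"
    by (simp add: diff_divide_distrib)
  finally show "norm (gauss_series (x + h) - gauss_series x)
      \<le> C * \<bar>h\<bar> powr (1/2 + 1 / (2 * \<mu>) - e / 2)" .
qed


section \<open>Hausdorff content\<close>

definition hausdorff_content :: "real \<Rightarrow> 'a::metric_space set \<Rightarrow> ennreal" where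
  "hausdorff_content s A =
     (INF U \<in> {U :: nat \<Rightarrow> 'a set. (\<forall>i. bounded (U i)) \<and> A \<subseteq> (\<Union>i. U i)}.
        (\<Sum>i. hausdorff_content_term s (U i)))"

lemma hausdorff_content_le:
  assumes "\<And>i. bounded (U i)" "A \<subseteq> (\<Union>i. U i)"
  shows "hausdorff_content s A \<le> (\<Sum>i. hausdorff_content_term s (U i))"
  unfolding hausdorff_content_def using assms by (intro INF_lower) auto

lemma hausdorff_content_lessE:
  assumes "hausdorff_content s A < r"
  obtains U where "\<And>i. bounded (U i)" "A \<subseteq> (\<Union>i. U i)" "(\<Sum>i. hausdorff_content_term s (U i)) < r"
  using assms unfolding hausdorff_content_def INF_less_iff by blast

lemma hausdorff_content_mono:
  assumes "A \<subseteq> B"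
  shows "hausdorff_content s A \<le> hausdorff_content s B"
  unfolding hausdorff_content_def using assms by (intro INF_superset_mono) auto

lemma hausdorff_content_eq_0_subset:
  assumes "hausdorff_content s B = 0" "A \<subseteq> B"
  shows "hausdorff_content s A = 0"
  using hausdorff_content_mono[OF assms(2), of s] assms(1) by simp

lemma hausdorff_content_le_term:
  assumes "bounded A"
  shows "hausdorff_content s A \<le> hausdorff_content_term s A"
proof -
  define U where "U i = (if i = 0 then A else {})" for i :: nat
  have "hausdorff_content s A \<le> (\<Sum>i. hausdorff_content_term s (U i))"
    using assms by (intro hausdorff_content_le) (auto simp: U_def)
  also have "\<dots> = (\<Sum>i\<in>{0}. hausdorff_content_term s (U i))"
    by (rule suminf_finite) (auto simp: U_def hausdorff_content_term_def)
  finally show ?thesis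
    by (simp add: U_def)
qed

lemma hausdorff_content_empty [simp]: "hausdorff_content s {} = 0"
  using hausdorff_content_le_term[of "{}" s] by (simp add: hausdorff_content_term_def)

lemma hausdorff_content_subset_cball_le:
  assumes "0 < s" "0 \<le> r" "A \<subseteq> cball a r"
  shows "hausdorff_content s A \<le> ennreal ((2 * r) powr s)"
proof -
  have "bounded A"
    using assms(3) bounded_cball bounded_subset by blast
  have "dist x y \<le> 2 * r" if "x \<in> A" "y \<in> A" for x y
  proof -
    have "dist a x \<le> r" "dist a y \<le> r"
      using that assms(3) by auto
    then show ?thesis
      using dist_triangle3[of x y a] by linarith
  qed
  then have "diameter A \<le> 2 * r"
    using assms(2) by (auto simp: diameter_def intro!: cSUP_least)
  then have "diameter A powr s \<le> (2 * r) powr s"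
    using assms(1) \<open>bounded A\<close> by (intro powr_mono2 diameter_ge_0) auto
  then show ?thesis
    using hausdorff_content_le_term[OF \<open>bounded A\<close>, of s] assms(1)
    by (auto simp: hausdorff_content_term_def ennreal_leI intro: order_trans split: if_splits)
qed

lemma hausdorff_content_countable_subadditive:
  fixes A :: "nat \<Rightarrow> 'a::metric_space set"
  shows "hausdorff_content s (\<Union>n. A n) \<le> (\<Sum>n. hausdorff_content s (A n))"
proof (rule ennreal_le_epsilon)
  fix e :: real assume e: "0 < e" and fin: "(\<Sum>n. hausdorff_content s (A n)) < top"
  define r where "r n = e * (1/2) ^ Suc n" for n
  have "hausdorff_content s (A n) < hausdorff_content s (A n) + ennreal (r n)" for n
    using ennreal_suminf_lessD[OF fin, of n] e by (simp add: r_def flip: less_top)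
  then have "\<exists>U. (\<forall>i. bounded (U i)) \<and> A n \<subseteq> (\<Union>i. U i) \<and>
      (\<Sum>i. hausdorff_content_term s (U i)) < hausdorff_content s (A n) + ennreal (r n)" for n
    by (metis hausdorff_content_lessE)
  then obtain U where U: "\<And>n i. bounded (U n i)" "\<And>n. A n \<subseteq> (\<Union>i. U n i)"
    "\<And>n. (\<Sum>i. hausdorff_content_term s (U n i)) < hausdorff_content s (A n) + ennreal (r n)"
    by metis
  define V where "V k = case_prod U (prod_decode k)" for k
  have "U n i \<subseteq> (\<Union>k. V k)" for n i
    using UN_upper[of "prod_encode (n, i)" UNIV V] by (simp add: V_def)
  then have "(\<Union>n. A n) \<subseteq> (\<Union>k. V k)"
    using U(2) by (intro UN_least) (meson UN_least order_trans)
  then have "hausdorff_content s (\<Union>n. A n) \<le> (\<Sum>k. hausdorff_content_term s (V k))"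
    by (intro hausdorff_content_le) (simp_all add: V_def U(1) case_prod_beta)
  also have "\<dots> = (\<Sum>n. \<Sum>i. hausdorff_content_term s (U n i))"
    using suminf_ennreal_2dimen[where f = "\<lambda>p. hausdorff_content_term s (case_prod U p)"]
    by (simp add: V_def)
  also have "\<dots> \<le> (\<Sum>n. hausdorff_content s (A n) + ennreal (r n))"
    using U(3) by (intro suminf_le less_imp_le) auto
  also have "\<dots> = (\<Sum>n. hausdorff_content s (A n)) + (\<Sum>n. ennreal (r n))"
    by (rule suminf_add[symmetric]) auto
  also have "(\<Sum>n. ennreal (r n)) = ennreal e"
    using sums_mult[OF power_half_series, of e] e by (intro suminf_ennreal_eq) (auto simp: r_def)
  finally show "hausdorff_content s (\<Union>n. A n) \<le> (\<Sum>n. hausdorff_content s (A n)) + ennreal e" .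
qed

lemma hausdorff_content_Un_le:
  "hausdorff_content s (A \<union> B) \<le> hausdorff_content s A + hausdorff_content s B"
  using hausdorff_content_countable_subadditive[of s "binaryset A B"]
  by (simp add: UN_binaryset_eq suminf_binaryset_eq)

lemma hausdorff_content_finite_UN_le:
  assumes "finite I"
  shows "hausdorff_content s (\<Union>i\<in>I. A i) \<le> (\<Sum>i\<in>I. hausdorff_content s (A i))"
  using assms
proof (induction I)
  case (insert i I)
  then show ?case
    using hausdorff_content_Un_le[of s "A i" "\<Union>i\<in>I. A i"] by (auto intro: order_trans add_left_mono)
qed simp

lemma hausdorff_content_countable_UN_eq_0:
  assumes "countable I" "\<And>i. i \<in> I \<Longrightarrow> hausdorff_content s (A i) = 0"
  shows "hausdorff_content s (\<Union>i\<in>I. A i) = 0"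
proof (cases "I = {}")
  case False
  then have "(\<Union>i\<in>I. A i) = (\<Union>n. A (from_nat_into I n))"
    using range_from_nat_into[OF False assms(1)] by (metis image_image)
  then show ?thesis
    using hausdorff_content_countable_subadditive[of s "\<lambda>n. A (from_nat_into I n)"]
      assms(2)[OF from_nat_into[OF False]] by simp
qed simp

lemma hausdorff_content_countable_eq_0:
  fixes A :: "'a::metric_space set"
  assumes "0 < s" "countable A"
  shows "hausdorff_content s A = 0"
proof -
  have "hausdorff_content s {x} = 0" for x :: 'a
    using hausdorff_content_subset_cball_le[OF assms(1), of 0 "{x}" x] by simp
  then show ?thesis
    using hausdorff_content_countable_UN_eq_0[OF assms(2), of s "\<lambda>x. {x}"] by simp
qed

lemma hausdorff_content_Borel_Cantelli:
  fixes V :: "nat \<Rightarrow> 'a::metric_space set"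
  assumes "summable b" "\<And>n. 0 \<le> b n" "\<And>n. hausdorff_content s (V n) \<le> ennreal (b n)"
  shows "hausdorff_content s {x. \<exists>\<^sub>F n in sequentially. x \<in> V n} = 0"
    (is "hausdorff_content s ?L = 0")
proof -
  have "hausdorff_content s ?L \<le> 0 + ennreal e" if e: "0 < e" for e
  proof -
    obtain N where N: "norm (\<Sum>n. b (n + N)) < e"
      using suminf_exist_split[OF e assms(1)] by blast
    have "?L \<subseteq> (\<Union>n. V (n + N))"
      by (auto simp: frequently_sequentially) (metis le_add_diff_inverse2)
    then have "hausdorff_content s ?L \<le> hausdorff_content s (\<Union>n. V (n + N))"
      by (rule hausdorff_content_mono)
    also have "\<dots> \<le> (\<Sum>n. hausdorff_content s (V (n + N)))"
      by (rule hausdorff_content_countable_subadditive)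
    also have "\<dots> \<le> (\<Sum>n. ennreal (b (n + N)))"
      by (intro suminf_le assms(3)) auto
    also have "\<dots> = ennreal (\<Sum>n. b (n + N))"
      by (intro suminf_ennreal2 assms(2) summable_ignore_initial_segment assms(1))
    also have "\<dots> \<le> ennreal e"
      using N by (intro ennreal_leI) auto
    finally show ?thesis by simp
  qed
  then have "hausdorff_content s ?L \<le> 0"
    by (rule ennreal_le_epsilon)
  then show ?thesis by simp
qed

text \<open>A cover of small total \<open>s\<close>-content automatically consists of sets of small diameter.\<close>
lemma hausdorff_measure_eq_0:
  assumes "0 < s" "hausdorff_content s A = 0"
  shows "hausdorff_measure s A = 0"
proof -
  have "hausdorff_pre \<delta> s A \<le> 0 + ennreal e" if "0 < \<delta>" "0 < e" for \<delta> e
  proof -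
    have "hausdorff_content s A < ennreal (min e (\<delta> powr s))"
      using assms(2) that by simp
    then obtain U where U: "\<And>i. bounded (U i)" "A \<subseteq> (\<Union>i. U i)"
      "(\<Sum>i. hausdorff_content_term s (U i)) < ennreal (min e (\<delta> powr s))"
      by (metis hausdorff_content_lessE)
    have "diameter (U i) \<le> \<delta>" for i
    proof (cases "U i = {}")
      case False
      have "hausdorff_content_term s (U i) \<le> (\<Sum>i. hausdorff_content_term s (U i))"
        using sum_le_suminf[OF summableI, of "{i}" "\<lambda>i. hausdorff_content_term s (U i)"] by simp
      also note U(3)
      finally have "diameter (U i) powr s < \<delta> powr s"
        using False assms(1) by (simp add: hausdorff_content_term_def ennreal_less_iff)
      then show ?thesis
        using powr_mono2[of s \<delta> "diameter (U i)"] assms(1) that(1) by linarith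
    qed (use that in auto)
    then have "hausdorff_pre \<delta> s A \<le> (\<Sum>i. hausdorff_content_term s (U i))"
      unfolding hausdorff_pre_def using U by (intro INF_lower) auto
    also have "\<dots> \<le> ennreal e"
      using U(3) by (meson ennreal_leI less_imp_le min.cobounded1 order_trans)
    finally show ?thesis by simp
  qed
  then have "hausdorff_pre \<delta> s A \<le> 0" if "0 < \<delta>" for \<delta>
    by (rule ennreal_le_epsilon) (use that in auto)
  then have "hausdorff_measure s A \<le> 0"
    unfolding hausdorff_measure_def by (intro SUP_least) auto
  then show ?thesis by simp
qed

lemma hausdorff_dim_le:
  fixes d :: real
  assumes "0 \<le> d" "\<And>s. d < s \<Longrightarrow> hausdorff_content s A = 0"
  shows "hausdorff_dim A \<le> ereal d"
proof (rule dense_ge)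
  fix y assume "ereal d < y"
  then obtain s where s: "d < s" "ereal s < y"
    using ereal_dense2 by force
  have "hausdorff_measure s A = 0"
    using assms s(1) by (intro hausdorff_measure_eq_0) auto
  then have "hausdorff_dim A \<le> ereal s"
    unfolding hausdorff_dim_def using assms(1) s(1) by (intro Inf_lower) auto
  with s(2) show "hausdorff_dim A \<le> y" by simp
qed

lemma hausdorff_dim_mono:
  assumes "A \<subseteq> B"
  shows "hausdorff_dim A \<le> hausdorff_dim B"
proof -
  have "hausdorff_measure s A \<le> hausdorff_measure s B" for s
    unfolding hausdorff_measure_def hausdorff_pre_def using assms
    by (intro SUP_mono' INF_superset_mono) auto
  then have "hausdorff_measure s A = 0" if "hausdorff_measure s B = 0" for s
    using that by (metis le_zero_eq)
  then show ?thesis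
    unfolding hausdorff_dim_def by (intro Inf_superset_mono image_mono) auto
qed


section \<open>Images of well-approximable points\<close>

definition well_approximable :: "real \<Rightarrow> real set" where
  "well_approximable \<mu> = {x. \<exists>\<^sub>F q in sequentially. \<exists>p.
    coprime p (int q) \<and> \<bar>x - of_int p / real q\<bar> \<le> real q powr (- \<mu>)}"

lemma irrational_well_approximable_2:
  assumes "x \<notin> \<rat>"
  shows "x \<in> well_approximable 2"
  unfolding well_approximable_def frequently_sequentially
proof (intro CollectI allI)
  fix Q :: nat
  have "infinite (approx_set x)"
    using assms rational_iff_finite_approx_set by blast
  then obtain p k where pk: "(p, k) \<in> approx_set x" "int Q < k"
    using infinite_approx_set by blast
  define q where "q = nat k"
  have q: "k = int q" "Q \<le> q" "0 < q"
    using pk(2) by (auto simp: q_def)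
  have "coprime p (int q)" "\<bar>x - of_int p / real q\<bar> \<le> real q powr (- 2)"
    using pk(1) q by (auto simp: approx_set_def powr_minus_divide)
  then show "\<exists>q\<ge>Q. \<exists>p. coprime p (int q) \<and> \<bar>x - of_int p / real q\<bar> \<le> real q powr (- 2)"
    using q(2) by blast
qed

lemma irrational_distance_ge:
  fixes x :: real
  assumes "x \<notin> \<rat>"
  shows "\<exists>c>0. \<forall>p q. 0 < q \<longrightarrow> q < Q \<longrightarrow> c \<le> \<bar>x - of_int p / real q\<bar>"
proof (intro exI conjI allI impI)
  define c where "c = Min (insert 1 ((\<lambda>q. infdist (real q * x) \<int> / real q) ` {0<..<Q}))"
  have "real q * x \<notin> \<int>" if "0 < q" for q
  proof
    assume "real q * x \<in> \<int>"
    then have "real q * x / real q \<in> \<rat>"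
      using Ints_subset_Rats by (intro Rats_divide) auto
    then show False
      using assms that by simp
  qed
  then show "0 < c"
    by (auto simp: c_def intro!: divide_pos_pos infdist_Ints_pos)
  fix p :: int and q :: nat
  assume q: "0 < q" "q < Q"
  then have "c \<le> infdist (real q * x) \<int> / real q"
    by (auto simp: c_def)
  also have "\<dots> \<le> \<bar>real q * x - of_int p\<bar> / real q"
    by (intro divide_right_mono infdist_Ints_le) simp
  also have "\<dots> = \<bar>(real q * x - of_int p) / real q\<bar>"
    by (simp add: abs_divide)
  also have "(real q * x - of_int p) / real q = x - of_int p / real q"
    using q(1) by (simp add: diff_divide_distrib)
  finally show "c \<le> \<bar>x - of_int p / real q\<bar>" .
qed

lemma Diophantine_condition_if_not_well_approximable:
  assumes x: "x \<notin> \<rat>" "x \<notin> well_approximable \<mu>" and \<mu>: "0 \<le> \<mu>"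
  shows "\<exists>c>0. Diophantine_condition c \<mu> x"
proof -
  obtain Q where Q: "\<And>p q. Q \<le> q \<Longrightarrow> coprime p (int q) \<Longrightarrow> real q powr (- \<mu>) < \<bar>x - of_int p / real q\<bar>"
    using x(2) unfolding well_approximable_def frequently_sequentially mem_Collect_eq
    by (metis not_le)
  obtain c where c: "0 < c" "\<And>p q. 0 < q \<Longrightarrow> q < Q \<Longrightarrow> c \<le> \<bar>x - of_int p / real q\<bar>"
    using irrational_distance_ge[OF x(1)] by metis
  have "min 1 c * real q powr (- \<mu>) \<le> \<bar>x - of_int p / real q\<bar>"
    if "coprime p (int q)" "0 < q" for p q
  proof (cases "Q \<le> q")
    case True
    have "min 1 c * real q powr (- \<mu>) \<le> 1 * real q powr (- \<mu>)"
      by (intro mult_right_mono) auto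
    then show ?thesis
      using Q[OF True that(1)] by simp
  next
    case False
    have "real q powr (- \<mu>) \<le> real q powr 0"
      using that(2) \<mu> by (intro powr_mono) auto
    then have "min 1 c * real q powr (- \<mu>) \<le> c * 1"
      using c(1) that(2) by (intro mult_mono) auto
    then show ?thesis
      using c(2)[of q p] that(2) False by simp
  qed
  then have "Diophantine_condition (min 1 c) \<mu> x"
    by (simp add: Diophantine_condition_def)
  then show ?thesis
    using c(1) by (intro exI[of _ "min 1 c"]) simp
qed

definition numerators :: "nat \<Rightarrow> nat \<Rightarrow> int set" where
  "numerators n q = {p. coprime p (int q) \<and> \<bar>p\<bar> \<le> int (Suc n * q)}"

definition near_fractions :: "real \<Rightarrow> nat \<Rightarrow> nat \<Rightarrow> real set" where
  "near_fractions \<mu> n q = (\<Union>p\<in>numerators n q. {x. \<bar>x - of_int p / real q\<bar> \<le> real q powr (- \<mu>)})"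

lemma numerators_subset: "numerators n q \<subseteq> {- int (Suc n * q)..int (Suc n * q)}"
  by (auto simp: numerators_def)

lemma numerators_0 [simp]: "numerators n 0 = {}"
  by (simp add: numerators_def)

lemma card_numerators_le:
  assumes "0 < q"
  shows "card (numerators n q) \<le> (2 * n + 3) * q"
proof -
  define a where "a = Suc n * q"
  have "card (numerators n q) \<le> card {- int a..int a}"
    unfolding a_def by (intro card_mono numerators_subset) simp
  also have "\<dots> = 2 * a + 1"
    by simp
  also have "\<dots> \<le> (2 * n + 3) * q"
    using assms by (simp add: a_def algebra_simps)
  finally show ?thesis .
qed

lemma well_approximable_subset_near_fractions:
  assumes "0 \<le> \<mu>"
  shows "well_approximable \<mu> \<subseteq> (\<Union>n. {x. \<exists>\<^sub>F q in sequentially. x \<in> near_fractions \<mu> n q})"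
proof
  fix x assume x: "x \<in> well_approximable \<mu>"
  obtain n where n: "\<bar>x\<bar> \<le> real n"
    using real_arch_simple by blast
  have near: "x \<in> near_fractions \<mu> n q"
    if "0 < q" "coprime p (int q)" "\<bar>x - of_int p / real q\<bar> \<le> real q powr (- \<mu>)" for p q
  proof -
    have "real q powr (- \<mu>) \<le> real q powr 0"
      using that(1) assms by (intro powr_mono) auto
    then have "\<bar>of_int p / real q\<bar> \<le> real (Suc n)"
      using that n by simp
    then have "\<bar>of_int p\<bar> \<le> real (Suc n * q)"
      using that(1) by (simp add: abs_divide field_simps)
    then have "\<bar>p\<bar> \<le> int (Suc n * q)"
      by linarith
    then show ?thesis
      using that by (auto simp: near_fractions_def numerators_def)
  qed
  have "\<forall>\<^sub>F q in sequentially.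
      (\<exists>p. coprime p (int q) \<and> \<bar>x - of_int p / real q\<bar> \<le> real q powr (- \<mu>)) \<longrightarrow>
        x \<in> near_fractions \<mu> n q"
    using eventually_gt_at_top[of "0::nat"] by eventually_elim (use near in blast)
  then have "\<exists>\<^sub>F q in sequentially. x \<in> near_fractions \<mu> n q"
    using x unfolding well_approximable_def by (blast intro: frequently_rev_mp)
  then show "x \<in> (\<Union>n. {x. \<exists>\<^sub>F q in sequentially. x \<in> near_fractions \<mu> n q})"
    by blast
qed

lemma hausdorff_content_image_near_fractions_le:
  fixes f :: "real \<Rightarrow> 'a::metric_space"
  assumes "0 < s" "0 \<le> C" "0 < q"
    and f: "\<And>p x. coprime p (int q) \<Longrightarrow> \<bar>x - of_int p / real q\<bar> \<le> real q powr (- \<mu>) \<Longrightarrow>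
      dist (f (of_int p / real q)) (f x) \<le> C * real q powr (- \<tau>)"
  shows "hausdorff_content s (f ` near_fractions \<mu> n q)
    \<le> ennreal ((2 * real n + 3) * (2 * C) powr s * real q powr (1 - s * \<tau>))"
proof -
  define J where "J p = {x. \<bar>x - of_int p / real q\<bar> \<le> real q powr (- \<mu>)}" for p
  define b where "b = (2 * C) powr s * real q powr (- (s * \<tau>))"
  have interval: "hausdorff_content s (f ` J p) \<le> ennreal b" if "p \<in> numerators n q" for p
  proof -
    have "f ` J p \<subseteq> cball (f (of_int p / real q)) (C * real q powr (- \<tau>))"
      using that by (auto simp: numerators_def J_def intro: f)
    then have "hausdorff_content s (f ` J p) \<le> ennreal ((2 * (C * real q powr (- \<tau>))) powr s)"
      using assms by (intro hausdorff_content_subset_cball_le) auto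
    also have "(2 * (C * real q powr (- \<tau>))) powr s = b"
      unfolding b_def mult.assoc[symmetric] powr_mult[of "2 * C"] powr_powr
      by (simp add: mult.commute)
    finally show ?thesis .
  qed
  have "f ` near_fractions \<mu> n q = (\<Union>p\<in>numerators n q. f ` J p)"
    by (auto simp: near_fractions_def J_def)
  then have "hausdorff_content s (f ` near_fractions \<mu> n q)
      \<le> (\<Sum>p\<in>numerators n q. hausdorff_content s (f ` J p))"
    using finite_subset[OF numerators_subset] by (simp add: hausdorff_content_finite_UN_le)
  also have "\<dots> \<le> (\<Sum>p\<in>numerators n q. ennreal b)"
    by (intro sum_mono interval)
  also have "\<dots> = ennreal (real (card (numerators n q)) * b)"
    by (simp add: b_def ennreal_mult ennreal_of_nat_eq_real_of_nat)
  also have "\<dots> \<le> ennreal (real ((2 * n + 3) * q) * b)"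
    using assms(3)
    by (intro ennreal_leI mult_right_mono of_nat_mono card_numerators_le) (auto simp: b_def)
  also have "real ((2 * n + 3) * q) * b
      = (2 * real n + 3) * (2 * C) powr s * (real q * real q powr (- (s * \<tau>)))"
    by (simp add: b_def)
  also have "real q * real q powr (- (s * \<tau>)) = real q powr (1 - s * \<tau>)"
    by (simp add: powr_mult_base)
  finally show ?thesis .
qed

theorem hausdorff_content_image_well_approximable_eq_0:
  fixes f :: "real \<Rightarrow> 'a::metric_space"
  assumes "0 < s" "0 \<le> \<mu>" "2 < s * \<tau>" "0 \<le> C"
    and f: "\<And>p q x. coprime p (int q) \<Longrightarrow> 0 < q \<Longrightarrow> \<bar>x - of_int p / real q\<bar> \<le> real q powr (- \<mu>) \<Longrightarrow>
      dist (f (of_int p / real q)) (f x) \<le> C * real q powr (- \<tau>)"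
  shows "hausdorff_content s (f ` well_approximable \<mu>) = 0"
proof -
  have "hausdorff_content s {y. \<exists>\<^sub>F q in sequentially. y \<in> f ` near_fractions \<mu> n q} = 0" for n
  proof (rule hausdorff_content_Borel_Cantelli)
    have "summable (\<lambda>q. real q powr (1 - s * \<tau>))"
      using assms(3) by (simp add: summable_real_powr_iff)
    then show "summable (\<lambda>q. (2 * real n + 3) * (2 * C) powr s * real q powr (1 - s * \<tau>))"
      by (rule summable_mult)
    fix q :: nat
    show "hausdorff_content s (f ` near_fractions \<mu> n q)
        \<le> ennreal ((2 * real n + 3) * (2 * C) powr s * real q powr (1 - s * \<tau>))"
    proof (cases "q = 0")
      case True
      then show ?thesis
        by (simp add: near_fractions_def)
    next
      case False
      then show ?thesis
        using assms by (intro hausdorff_content_image_near_fractions_le) auto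
    qed
  qed simp
  then have "hausdorff_content s (\<Union>n. {y. \<exists>\<^sub>F q in sequentially. y \<in> f ` near_fractions \<mu> n q}) = 0"
    by (intro hausdorff_content_countable_UN_eq_0) auto
  moreover have "f ` well_approximable \<mu>
      \<subseteq> (\<Union>n. {y. \<exists>\<^sub>F q in sequentially. y \<in> f ` near_fractions \<mu> n q})"
    using well_approximable_subset_near_fractions[OF assms(2)]
    by (fastforce elim!: frequently_elim1)
  ultimately show ?thesis
    by (rule hausdorff_content_eq_0_subset)
qed


section \<open>The image of \<open>\<phi>\<close>\<close>

lemma gauss_series_has_sum: "((\<lambda>n. gauss_term x (Suc n)) has_sum gauss_series x) UNIV"
  unfolding gauss_series_def
  by (intro norm_summable_imp_has_sum summable_norm_gauss_term summable_sums
      summable_norm_cancel[OF summable_norm_gauss_term])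

lemma has_sum_int_split:
  fixes f :: "int \<Rightarrow> 'a :: topological_comm_monoid_add"
  assumes "((\<lambda>n. f (int (Suc n))) has_sum a) UNIV" "((\<lambda>n. f (- int (Suc n))) has_sum b) UNIV"
  shows "(f has_sum (f 0 + (a + b))) UNIV"
proof -
  define P M where "P = range (\<lambda>n. int (Suc n))" and "M = range (\<lambda>n. - int (Suc n))"
  have inj: "inj (\<lambda>n. int (Suc n))" "inj (\<lambda>n. - int (Suc n))"
    by (simp_all add: inj_def)
  have "(f has_sum a) P" "(f has_sum b) M"
    unfolding P_def M_def using assms
    by (simp_all only: has_sum_reindex[OF inj(1)] has_sum_reindex[OF inj(2)] o_def)
  moreover have "(f has_sum f 0) {0}"
    using has_sum_finite[of "{0}" f] by simp
  ultimately have "(f has_sum (f 0 + (a + b))) ({0} \<union> (P \<union> M))"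
    by (intro has_sum_Un_disjoint) (auto simp: P_def M_def)
  moreover have "k \<in> {0} \<union> (P \<union> M)" for k
    unfolding P_def M_def by (cases k rule: int_cases2; cases "nat \<bar>k\<bar>") auto
  ultimately show ?thesis
    by (metis UNIV_eq_I)
qed

lemma phi_term_eq_gauss_terms:
  assumes "k \<noteq> 0"
  shows "phi_term k t
    = (gauss_term 0 (nat \<bar>k\<bar>) - gauss_term (- 2 * pi * t) (nat \<bar>k\<bar>)) / of_real (4 * pi\<^sup>2)"
proof -
  have "exp (- 4 * complex_of_real (pi\<^sup>2) * \<i> * of_int (k\<^sup>2) * complex_of_real t)
      = cis2pi ((of_int k)\<^sup>2 * (- 2 * pi * t))"
    unfolding cis2pi_def cis_conv_exp by (rule arg_cong[of _ _ exp]) (simp add: power2_eq_square)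
  moreover have "complex_of_int \<bar>k\<bar> ^ 2 = of_int k ^ 2"
    by (metis of_int_power power2_abs)
  ultimately show ?thesis
    using assms by (simp add: phi_term_def gauss_term_def field_simps)
qed

lemma phi_eq_gauss_series:
  "phi t = \<i> * of_real t + (gauss_series 0 - gauss_series (- 2 * pi * t)) / of_real (2 * pi\<^sup>2)"
proof -
  define a where "a = (gauss_series 0 - gauss_series (- 2 * pi * t)) / of_real (4 * pi\<^sup>2)"
  have "((\<lambda>n. (gauss_term 0 (Suc n) - gauss_term (- 2 * pi * t) (Suc n)) / of_real (4 * pi\<^sup>2))
      has_sum a) UNIV"
    unfolding a_def diff_conv_add_uminus
    by (intro has_sum_divide_const has_sum_add has_sum_uminusI gauss_series_has_sum)
  then have "((\<lambda>k. phi_term k t) has_sum (phi_term 0 t + (a + a))) UNIV"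
    by (intro has_sum_int_split) (simp_all add: phi_term_eq_gauss_terms del: of_nat_Suc)
  then show ?thesis
    unfolding phi_def by (simp add: infsumI phi_term_def a_def field_simps)
qed

definition rescaled_phi :: "real \<Rightarrow> complex" where
  "rescaled_phi x = phi (- x / (2 * pi))"

lemma phi_eq_rescaled_phi: "phi t = rescaled_phi (- 2 * pi * t)"
  by (simp add: rescaled_phi_def)

lemma norm_rescaled_phi_diff_le:
  "norm (rescaled_phi x - rescaled_phi y) \<le> \<bar>x - y\<bar> + norm (gauss_series x - gauss_series y)"
proof -
  define G where "G = gauss_series x - gauss_series y"
  have pi: "1 \<le> 2 * pi" "1 \<le> 2 * pi\<^sup>2"
    using pi_ge_two power_mono[OF pi_ge_two, of 2] by simp_all
  have "rescaled_phi x - rescaled_phi y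
      = - (\<i> * of_real ((x - y) / (2 * pi))) - G / of_real (2 * pi\<^sup>2)"
    unfolding rescaled_phi_def phi_eq_gauss_series G_def by (simp add: field_simps)
  also have "norm \<dots> \<le> \<bar>x - y\<bar> / (2 * pi) + norm G / (2 * pi\<^sup>2)"
    by (rule order_trans[OF norm_triangle_ineq4])
      (simp add: norm_mult norm_divide norm_power del: of_real_diff of_real_divide)
  also have "\<dots> \<le> \<bar>x - y\<bar> / 1 + norm G / 1"
    using pi by (intro add_mono divide_left_mono) auto
  finally show ?thesis
    by (simp add: G_def)
qed

lemma dist_rescaled_phi_near_rational:
  assumes e: "0 < e" "e < 1" and \<mu>: "2 \<le> \<mu>"
  obtains C where "0 \<le> C" "\<And>p q x. coprime p (int q) \<Longrightarrow> 0 < q \<Longrightarrow>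
    \<bar>x - of_int p / real q\<bar> \<le> real q powr (- \<mu>) \<Longrightarrow>
    dist (rescaled_phi (of_int p / real q)) (rescaled_phi x)
      \<le> C * real q powr (- ((1 + \<mu> * (1 - e)) / 2))"
proof -
  define \<tau> where "\<tau> = (1 + \<mu> * (1 - e)) / 2"
  have "0 \<le> \<mu> * e"
    using \<mu> e by simp
  then have \<tau>: "\<tau> \<le> \<mu>"
    using \<mu> by (simp add: \<tau>_def algebra_simps)
  obtain C where C: "0 \<le> C" "\<And>p q x. coprime p (int q) \<Longrightarrow> 0 < q \<Longrightarrow>
      \<bar>x - of_int p / real q\<bar> \<le> real q powr (- \<mu>) \<Longrightarrow>
      norm (gauss_series x - gauss_series (of_int p / real q)) \<le> C * real q powr (- \<tau>)"
    using gauss_series_close_to_rational[OF assms] unfolding \<tau>_def by metis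
  have "dist (rescaled_phi (of_int p / real q)) (rescaled_phi x) \<le> (1 + C) * real q powr (- \<tau>)"
    if "coprime p (int q)" "0 < q" "\<bar>x - of_int p / real q\<bar> \<le> real q powr (- \<mu>)" for p q x
  proof -
    have "real q powr (- \<mu>) \<le> real q powr (- \<tau>)"
      using \<tau> that(2) by (intro powr_mono) auto
    then show ?thesis
      using C(2)[OF that] that(3) norm_rescaled_phi_diff_le[of x "of_int p / real q"]
      by (simp add: dist_norm norm_minus_commute algebra_simps)
  qed
  then show ?thesis
    using that[of "1 + C"] C(1) by (simp add: \<tau>_def)
qed

lemma hausdorff_dim_rescaled_phi_well_approximable_le:
  assumes \<mu>: "2 \<le> \<mu>"
  shows "hausdorff_dim (rescaled_phi ` (\<rat> \<union> well_approximable \<mu>)) \<le> ereal (4 / (1 + \<mu>))"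
proof (rule hausdorff_dim_le)
  show "0 \<le> 4 / (1 + \<mu>)"
    using \<mu> by simp
  fix s assume s: "4 / (1 + \<mu>) < s"
  then have "0 < s"
    using \<mu> by (smt (verit) divide_nonneg_nonneg)
  have "((\<lambda>e. s * ((1 + \<mu> * (1 - e)) / 2)) \<longlongrightarrow> s * ((1 + \<mu> * (1 - 0)) / 2)) (at_right 0)"
    by (intro tendsto_intros) auto
  moreover have "2 < s * ((1 + \<mu> * (1 - 0)) / 2)"
    using s \<mu> by (simp add: field_simps)
  ultimately have "\<forall>\<^sub>F e in at_right 0. 2 < s * ((1 + \<mu> * (1 - e)) / 2)"
    by (rule order_tendstoD)
  moreover have "\<forall>\<^sub>F e::real in at_right 0. 0 < e \<and> e < 1"
    using eventually_at_right_real[of 0 1] by simp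
  ultimately obtain e where e: "2 < s * ((1 + \<mu> * (1 - e)) / 2)" "0 < e" "e < 1"
    using eventually_happens'[OF trivial_limit_at_right_real, OF eventually_conj] by blast
  obtain C where "0 \<le> C" "\<And>p q x. coprime p (int q) \<Longrightarrow> 0 < q \<Longrightarrow>
      \<bar>x - of_int p / real q\<bar> \<le> real q powr (- \<mu>) \<Longrightarrow>
      dist (rescaled_phi (of_int p / real q)) (rescaled_phi x)
        \<le> C * real q powr (- ((1 + \<mu> * (1 - e)) / 2))"
    using dist_rescaled_phi_near_rational[OF e(2,3) \<mu>] by metis
  then have "hausdorff_content s (rescaled_phi ` well_approximable \<mu>) = 0"
    using \<open>0 < s\<close> \<mu> e(1) by (intro hausdorff_content_image_well_approximable_eq_0) auto
  moreover have "hausdorff_content s (rescaled_phi ` \<rat>) = 0"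
    by (intro hausdorff_content_countable_eq_0 \<open>0 < s\<close> countable_image countable_rat)
  ultimately show "hausdorff_content s (rescaled_phi ` (\<rat> \<union> well_approximable \<mu>)) = 0"
    using hausdorff_content_Un_le[of s "rescaled_phi ` \<rat>" "rescaled_phi ` well_approximable \<mu>"]
    by (simp add: image_Un)
qed

lemma hausdorff_dim_range_phi_le: "hausdorff_dim (range phi) \<le> ereal (4/3)"
proof -
  have "range phi \<subseteq> rescaled_phi ` (\<rat> \<union> well_approximable 2)"
    using irrational_well_approximable_2 phi_eq_rescaled_phi by blast
  then show ?thesis
    using hausdorff_dim_rescaled_phi_well_approximable_le[of 2] by (auto dest: hausdorff_dim_mono)
qed


section \<open>Points of low exponent\<close>

lemma pointwise_holderI:
  assumes "0 < \<beta>" "0 \<le> C" "0 < r"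
    and f: "\<And>h. h \<noteq> 0 \<Longrightarrow> \<bar>h\<bar> < r \<Longrightarrow> norm (f (x + h) - f x) \<le> C * \<bar>h\<bar> powr \<beta>"
  shows "pointwise_holder \<beta> f x"
  unfolding pointwise_holder_def
proof (intro exI conjI)
  show "real (degree [:f x:]) \<le> \<beta>" "0 < C + 1"
    using assms by simp_all
  have "\<forall>\<^sub>F h in nhds 0. \<bar>h\<bar> < r"
    using assms(3) by (auto simp: eventually_nhds_metric dist_real_def)
  then show "\<forall>\<^sub>F h in nhds 0.
      norm (f (x + h) - poly [:f x:] (complex_of_real h)) \<le> (C + 1) * abs_pow h \<beta>"
  proof eventually_elim
    case (elim h)
    show ?case
    proof (cases "h = 0")
      case False
      have "C * \<bar>h\<bar> powr \<beta> \<le> (C + 1) * \<bar>h\<bar> powr \<beta>"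
        by (intro mult_right_mono) auto
      then show ?thesis
        using f[OF False elim] assms(1) by (simp add: abs_pow_def)
    qed (use assms in \<open>simp add: abs_pow_def\<close>)
  qed
qed

lemma pointwise_holder_phi:
  assumes e: "0 < e" "e < 1" and \<mu>: "2 \<le> \<mu>" and c: "0 < c"
    and x: "Diophantine_condition c \<mu> (- 2 * pi * t)"
  shows "pointwise_holder (1/2 + 1 / (2 * \<mu>) - e / 2) phi t"
proof -
  define \<beta> where "\<beta> = 1/2 + 1 / (2 * \<mu>) - e / 2"
  obtain C where C: "0 \<le> C" "\<And>h. \<bar>h\<bar> \<le> 1 \<Longrightarrow>
      norm (gauss_series (- 2 * pi * t + h) - gauss_series (- 2 * pi * t)) \<le> C * \<bar>h\<bar> powr \<beta>"
    using gauss_series_Diophantine[OF e \<mu> c x] unfolding \<beta>_def by metis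
  have "1 / (2 * \<mu>) \<le> 1/4" "0 < 1 / (2 * \<mu>)"
    using \<mu> by (auto simp: field_simps)
  then have \<beta>: "0 < \<beta>" "\<beta> \<le> 1"
    using e unfolding \<beta>_def by linarith+
  have "pointwise_holder \<beta> phi t"
  proof (rule pointwise_holderI[OF \<beta>(1), of "(1 + C) * (2 * pi) powr \<beta>" "1 / (2 * pi)"])
    fix h :: real assume h: "h \<noteq> 0" "\<bar>h\<bar> < 1 / (2 * pi)"
    define k where "k = - 2 * pi * h"
    have k: "k \<noteq> 0" "\<bar>k\<bar> \<le> 1"
      using h by (auto simp: k_def abs_mult field_simps)
    have "\<bar>k\<bar> powr 1 \<le> \<bar>k\<bar> powr \<beta>"
      using k \<beta> by (intro powr_mono') auto
    moreover have "phi (t + h) = rescaled_phi (- 2 * pi * t + k)"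
      by (simp add: phi_eq_rescaled_phi k_def algebra_simps)
    ultimately have "norm (phi (t + h) - phi t) \<le> \<bar>k\<bar> powr \<beta> + C * \<bar>k\<bar> powr \<beta>"
      using norm_rescaled_phi_diff_le[of "- 2 * pi * t + k" "- 2 * pi * t"] C(2)[OF k(2)]
      by (simp add: phi_eq_rescaled_phi[of t])
    also have "\<dots> = (1 + C) * (2 * pi) powr \<beta> * \<bar>h\<bar> powr \<beta>"
      by (simp add: k_def abs_mult powr_mult algebra_simps)
    finally show "norm (phi (t + h) - phi t) \<le> (1 + C) * (2 * pi) powr \<beta> * \<bar>h\<bar> powr \<beta>" .
  qed (use C(1) in auto)
  then show ?thesis
    by (simp add: \<beta>_def)
qed

lemma holder_exponent_phi_ge:
  assumes \<mu>: "2 \<le> \<mu>" and x: "- 2 * pi * t \<notin> \<rat> \<union> well_approximable \<mu>"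
  shows "ereal (1/2 + 1 / (2 * \<mu>)) \<le> holder_exponent phi t"
proof (rule tendsto_upperbound)
  obtain c where c: "0 < c" "Diophantine_condition c \<mu> (- 2 * pi * t)"
    using Diophantine_condition_if_not_well_approximable[of "- 2 * pi * t" \<mu>] x \<mu> by auto
  show "\<forall>\<^sub>F e in at_right 0. ereal (1/2 + 1 / (2 * \<mu>) - e / 2) \<le> holder_exponent phi t"
    using eventually_at_right_real[of 0 1, OF zero_less_one]
  proof eventually_elim
    case (elim e)
    have "0 \<le> 1 / (2 * \<mu>)"
      using \<mu> by simp
    with elim have "0 \<le> 1/2 + 1 / (2 * \<mu>) - e / 2"
      unfolding greaterThanLessThan_iff by linarith
    then show ?case
      unfolding holder_exponent_def using pointwise_holder_phi[OF _ _ \<mu> c] elim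
      by (intro Sup_upper) auto
  qed
  have "((\<lambda>e. 1/2 + 1 / (2 * \<mu>) - e / 2) \<longlongrightarrow> 1/2 + 1 / (2 * \<mu>) - 0 / 2) (at_right 0)"
    by (intro tendsto_intros) auto
  then show "((\<lambda>e. ereal (1/2 + 1 / (2 * \<mu>) - e / 2)) \<longlongrightarrow> ereal (1/2 + 1 / (2 * \<mu>))) (at_right 0)"
    by simp
qed simp

lemma hausdorff_dim_phi_low_exponent_le:
  assumes "1/2 < \<beta>" "\<beta> \<le> 3/4"
  shows "hausdorff_dim (phi ` {t. holder_exponent phi t < ereal \<beta>}) \<le> ereal ((4 * \<beta> - 2) / \<beta>)"
proof -
  define \<mu> where "\<mu> = 1 / (2 * \<beta> - 1)"
  have \<mu>: "2 \<le> \<mu>" "1/2 + 1 / (2 * \<mu>) = \<beta>" "4 / (1 + \<mu>) = (4 * \<beta> - 2) / \<beta>"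
    using assms by (auto simp: \<mu>_def field_simps)
  have "- 2 * pi * t \<in> \<rat> \<union> well_approximable \<mu>" if "holder_exponent phi t < ereal \<beta>" for t
    using holder_exponent_phi_ge[OF \<mu>(1), of t] that unfolding \<mu>(2) by (metis not_le)
  then have "phi ` {t. holder_exponent phi t < ereal \<beta>} \<subseteq> rescaled_phi ` (\<rat> \<union> well_approximable \<mu>)"
    using phi_eq_rescaled_phi by blast
  then show ?thesis
    using hausdorff_dim_rescaled_phi_well_approximable_le[OF \<mu>(1)] unfolding \<mu>(3)
    by (auto dest: hausdorff_dim_mono)
qed

lemma hausdorff_dim_phi_exponent_le:
  assumes "1/2 \<le> \<alpha>" "\<alpha> \<le> 3/4"
  shows "hausdorff_dim (phi ` {t. holder_exponent phi t \<le> ereal \<alpha>}) \<le> ereal ((4 * \<alpha> - 2) / \<alpha>)"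
    (is "hausdorff_dim (phi ` ?A) \<le> _")
proof (cases "\<alpha> = 3/4")
  case True
  have "hausdorff_dim (phi ` ?A) \<le> ereal (4/3)"
    by (rule order_trans[OF hausdorff_dim_mono hausdorff_dim_range_phi_le]) auto
  then show ?thesis
    unfolding True by simp
next
  case False
  show ?thesis
  proof (rule tendsto_lowerbound)
    show "((\<lambda>\<beta>. ereal ((4 * \<beta> - 2) / \<beta>)) \<longlongrightarrow> ereal ((4 * \<alpha> - 2) / \<alpha>)) (at_right \<alpha>)"
      using assms(1) by (intro tendsto_intros) auto
    have "\<alpha> < 3/4"
      using assms(2) False by simp
    from eventually_at_right_real[OF this]
    show "\<forall>\<^sub>F \<beta> in at_right \<alpha>. hausdorff_dim (phi ` ?A) \<le> ereal ((4 * \<beta> - 2) / \<beta>)"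
    proof eventually_elim
      case (elim \<beta>)
      then have "hausdorff_dim (phi ` ?A)
          \<le> hausdorff_dim (phi ` {t. holder_exponent phi t < ereal \<beta>})"
        by (intro hausdorff_dim_mono image_mono) (auto intro: order_le_less_trans)
      also have "\<dots> \<le> ereal ((4 * \<beta> - 2) / \<beta>)"
        using elim assms(1) by (intro hausdorff_dim_phi_low_exponent_le) auto
      finally show ?case .
    qed
  qed simp
qed

theorem theorem1p2:
  fixes \<alpha> :: real
  assumes "1/2 \<le> \<alpha>" and "\<alpha> \<le> 3/4"
  defines "D \<equiv> (\<lambda>\<sigma>::real. {x::real. holder_exponent phi x = ereal \<sigma>})"
  shows "hausdorff_dim (phi ` D \<alpha>)
           \<le> hausdorff_dim (phi ` (\<Union>\<sigma>\<in>{\<sigma>. 0 \<le> \<sigma> \<and> \<sigma> \<le> \<alpha>}. D \<sigma>))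
       \<and> hausdorff_dim (phi ` (\<Union>\<sigma>\<in>{\<sigma>. 0 \<le> \<sigma> \<and> \<sigma> \<le> \<alpha>}. D \<sigma>))
           \<le> ereal ((4 * \<alpha> - 2) / \<alpha>)"
    (is "_ \<le> hausdorff_dim (phi ` ?G) \<and> _")
proof
  show "hausdorff_dim (phi ` D \<alpha>) \<le> hausdorff_dim (phi ` ?G)"
    using assms(1) by (intro hausdorff_dim_mono image_mono UN_upper) auto
  have "?G \<subseteq> {t. holder_exponent phi t \<le> ereal \<alpha>}"
    by (auto simp: D_def)
  then have "hausdorff_dim (phi ` ?G) \<le> hausdorff_dim (phi ` {t. holder_exponent phi t \<le> ereal \<alpha>})"
    by (intro hausdorff_dim_mono image_mono)
  also have "\<dots> \<le> ereal ((4 * \<alpha> - 2) / \<alpha>)"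
    using assms(1,2) by (rule hausdorff_dim_phi_exponent_le)
  finally show "hausdorff_dim (phi ` ?G) \<le> ereal ((4 * \<alpha> - 2) / \<alpha>)" .
qed

end
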